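(* Let $(\Omega,\mathscr A,\mathbb P)$ be a probability space with a complete filtration $\mathscr F=(\mathscr F_t)_{t\ge 0}$ and let $W$ be a (real, standard) Brownian motion with respect to $\mathscr F$. Let $E$ be a separable real Banach space. Assume that $\mathscr F_\infty$ is $\mathbb P$-countably generated. Then there exists a strongly predictable process $\phi:\mathbb R_+\times\Omega\to E$ which is locally stochastically integrable and such that, writing $\zeta(t)=\int_0^t\phi\,dW$, the following holds: for every $\xi\in L^0(\Omega,\mathscr F_\infty;E)$ there exists an increasing sequence $(n_k)_{k\ge0}$ of natural numbers such that $$\lim_{k\to\infty}\zeta(n_k)=\xi\quad\text{in }L^0(\Omega;E).$$
   Context: $\mathscr F_\infty=\sigma(\mathscr F_t:t\ge0)$. $\mathscr F_\infty$ is $\mathbb P$-countably generated if it coincides, up to $\mathbb P$-null sets, with a $\sigma$-algebra generated by countably many sets. $L^0(\Omega;X)$ denotes the space of (equivalence classes of) strongly measurable maps $\Omega\to X$ with the topology of convergence in probability, and $L^0(\Omega,\mathscr F_\infty;E)$ the subspace of strongly $\mathscr F_\infty$-measurable maps. For $0<T<\infty$, an adapted step process on $[0,T]$ is a finite linear combination of processes $\mathbf 1_{(c,d]}\eta$ with $0\le c<d\le T$ and $\eta:\Omega\to E$ strongly $\mathscr F_c$-measurable; one sets $\int_0^t\mathbf 1_{(c,d]}\eta\,dW=(W(d\wedge t)-W(c\wedge t))\eta$ and extends by linearity. A strongly measurable adapted process $\phi:[0,T]\times\Omega\to E$ with $\langle\phi,x^*\rangle\in L^0(\Omega;L^2(0,T))$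 for all $x^*\in E^*$ is stochastically integrable on $[0,T]$ if there are adapted step processes $(\phi_n)_{n\ge1}$ such that (i) for all $x^*\in E^*$, $\langle\phi_n,x^*\rangle\to\langle\phi,x^*\rangle$ in $L^0(\Omega;L^2(0,T))$, and (ii) $\int_0^\cdot\phi_n\,dW$ converges to some $\zeta$ in $L^0(\Omega;C_b([0,T];E))$; then $\int_0^t\phi\,dW:=\zeta(t)$. A process $\phi:\mathbb R_+\times\Omega\to E$ is locally stochastically integrable if its restriction to $[0,T]$ is stochastically integrable for every $0<T<\infty$; its integral process $\zeta(t)=\int_0^t\phi\,dW$, $t\ge0$, is then defined consistently and has continuous paths. *)

theory Defs
  imports "HOL-Probability.Probability"
begin

section \<open>Strong measurability and convergence in probability\<close>

definition strongly_measurable :: "'a measure \<Rightarrow> ('a \<Rightarrow> 'e::topological_space) \<Rightarrow> bool" where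
  "strongly_measurable M f \<longleftrightarrow>
     (\<exists>s. (\<forall>i::nat. simple_function M (s i)) \<and> (\<forall>x\<in>space M. (\<lambda>i. s i x) \<longlonglongrightarrow> f x))"

lemma strongly_measurable_iff_borel:
  fixes f :: "'a \<Rightarrow> 'e::{metric_space, second_countable_topology}"
  shows "strongly_measurable M f \<longleftrightarrow> f \<in> borel_measurable M"
proof
  assume "strongly_measurable M f"
  then obtain s where s: "\<And>i::nat. simple_function M (s i)"
    and lim: "\<And>x. x \<in> space M \<Longrightarrow> (\<lambda>i. s i x) \<longlonglongrightarrow> f x"
    unfolding strongly_measurable_def by blast
  show "f \<in> borel_measurable M"
    using borel_measurable_LIMSEQ_metric[OF borel_measurable_simple_function[OF s] lim] by simp
next
  assume "f \<in> borel_measurable M"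
  from borel_measurable_implies_sequence_metric[OF this, of undefined]
  show "strongly_measurable M f"
    unfolding strongly_measurable_def by blast
qed

text \<open>
  Convergence in \<open>L\<^sup>0(\<Omega>;X)\<close>, where \<open>d\<close> is the (extended) metric of \<open>X\<close>; elements of \<open>X\<close> may be
  given by representatives, as for \<open>L\<^sup>2(0,T)\<close>. The outer measure agrees with the measure on
  measurable sets; it is used because the event may fail to be measurable inside a null set on
  which a path is irregular (\<open>M\<close> itself is not assumed to be complete).
\<close>

definition tendsto_L0 ::
    "'a measure \<Rightarrow> ('x \<Rightarrow> 'x \<Rightarrow> ennreal) \<Rightarrow> (nat \<Rightarrow> 'a \<Rightarrow> 'x) \<Rightarrow> ('a \<Rightarrow> 'x) \<Rightarrow> bool" where
  "tendsto_L0 M d X Y \<longleftrightarrow>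
     (\<forall>\<epsilon>::real. 0 < \<epsilon> \<longrightarrow>
       (\<lambda>n. outer_measure_of M {\<omega> \<in> space M. ennreal \<epsilon> < d (X n \<omega>) (Y \<omega>)}) \<longlonglongrightarrow> 0)"

definition edist :: "'e::metric_space \<Rightarrow> 'e \<Rightarrow> ennreal" where
  "edist x y = ennreal (dist x y)"

definition sqnorm_L2 :: "real \<Rightarrow> (real \<Rightarrow> real) \<Rightarrow> ennreal" where
  "sqnorm_L2 T f = (\<integral>\<^sup>+ t\<in>{0..T}. ennreal ((f t)\<^sup>2) \<partial>lborel)"

definition dist_L2 :: "real \<Rightarrow> (real \<Rightarrow> real) \<Rightarrow> (real \<Rightarrow> real) \<Rightarrow> ennreal" where
  "dist_L2 T f g =
     (let q = sqnorm_L2 T (\<lambda>t. f t - g t) in if q = \<infinity> then \<infinity> else ennreal (sqrt (enn2real q)))"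

definition dist_C :: "real \<Rightarrow> (real \<Rightarrow> 'e::metric_space) \<Rightarrow> (real \<Rightarrow> 'e) \<Rightarrow> ennreal" where
  "dist_C T f g = (SUP t\<in>{0..T}. ennreal (dist (f t) (g t)))"


section \<open>Filtrations, Brownian motion, predictability\<close>

text \<open>
  Processes and filtrations are indexed by \<^typ>\<open>real\<close>; only their values at times \<open>t \<ge> 0\<close> matter.
  A complete filtration is one for which \<open>F 0\<close> (hence every \<open>F t\<close>) contains all null sets of \<open>M\<close>.
\<close>

definition complete_filtration :: "'a measure \<Rightarrow> (real \<Rightarrow> 'a measure) \<Rightarrow> bool" where
  "complete_filtration M F \<longleftrightarrow>
     (\<forall>t\<ge>0. subalgebra M (F t)) \<and>
     (\<forall>s t. 0 \<le> s \<and> s \<le> t \<longrightarrow> sets (F s) \<subseteq> sets (F t)) \<and>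
     null_sets M \<subseteq> sets (F 0)"

definition F_infinity :: "'a measure \<Rightarrow> (real \<Rightarrow> 'a measure) \<Rightarrow> 'a measure" where
  "F_infinity M F = sigma (space M) (\<Union>t\<in>{0..}. sets (F t))"

definition countably_generated_mod_null :: "'a measure \<Rightarrow> 'a measure \<Rightarrow> bool" where
  "countably_generated_mod_null M G \<longleftrightarrow>
     (\<exists>C. countable C \<and> C \<subseteq> sets M \<and>
        (\<forall>A\<in>sets G. \<exists>B\<in>sigma_sets (space M) C. sym_diff A B \<in> null_sets M) \<and>
        (\<forall>B\<in>sigma_sets (space M) C. \<exists>A\<in>sets G. sym_diff A B \<in> null_sets M))"

definition brownian_motion ::
    "'a measure \<Rightarrow> (real \<Rightarrow> 'a measure) \<Rightarrow> (real \<Rightarrow> 'a \<Rightarrow> real) \<Rightarrow> bool" where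
  "brownian_motion M F W \<longleftrightarrow>
     (\<forall>t\<ge>0. W t \<in> borel_measurable (F t)) \<and>
     (AE \<omega> in M. W 0 \<omega> = 0) \<and>
     (AE \<omega> in M. continuous_on {0..} (\<lambda>t. W t \<omega>)) \<and>
     (\<forall>s t. 0 \<le> s \<and> s < t \<longrightarrow>
        distributed M lborel (\<lambda>\<omega>. W t \<omega> - W s \<omega>) (normal_density 0 (sqrt (t - s))) \<and>
        prob_space.indep_set M (sets (F s))
          (sets (vimage_algebra (space M) (\<lambda>\<omega>. W t \<omega> - W s \<omega>) borel)))"

definition predictable_sigma :: "'a measure \<Rightarrow> (real \<Rightarrow> 'a measure) \<Rightarrow> (real \<times> 'a) measure" where
  "predictable_sigma M F =
     sigma ({0..} \<times> space M)
       ({{s<..t} \<times> A | s t A. 0 \<le> s \<and> s < t \<and> A \<in> sets (F s)} \<union> {{0} \<times> A | A. A \<in> sets (F 0)})"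

definition strongly_predictable ::
    "'a measure \<Rightarrow> (real \<Rightarrow> 'a measure) \<Rightarrow> (real \<Rightarrow> 'a \<Rightarrow> 'e::topological_space) \<Rightarrow> bool" where
  "strongly_predictable M F \<phi> \<longleftrightarrow> strongly_measurable (predictable_sigma M F) (\<lambda>(t, \<omega>). \<phi> t \<omega>)"


section \<open>The stochastic integral\<close>

text \<open>
  An adapted step process is represented by a list of triples \<open>(c, d, \<eta>)\<close>, standing for the sum of
  the processes \<open>1\<^bsub>(c,d]\<^esub> \<eta>\<close>; scalar coefficients are absorbed into \<open>\<eta>\<close>.
\<close>

definition adapted_step ::
    "(real \<Rightarrow> 'a measure) \<Rightarrow> real \<Rightarrow> (real \<times> real \<times> ('a \<Rightarrow> 'e::real_normed_vector)) list \<Rightarrow> bool" where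
  "adapted_step F T ps \<longleftrightarrow>
     (\<forall>(c, d, \<eta>) \<in> set ps. 0 \<le> c \<and> c < d \<and> d \<le> T \<and> strongly_measurable (F c) \<eta>)"

definition step_process ::
    "(real \<times> real \<times> ('a \<Rightarrow> 'e::real_normed_vector)) list \<Rightarrow> real \<Rightarrow> 'a \<Rightarrow> 'e" where
  "step_process ps t \<omega> = (\<Sum>(c, d, \<eta>) \<leftarrow> ps. indicator {c<..d} t *\<^sub>R \<eta> \<omega>)"

definition step_integral ::
    "(real \<Rightarrow> 'a \<Rightarrow> real) \<Rightarrow> (real \<times> real \<times> ('a \<Rightarrow> 'e::real_normed_vector)) list \<Rightarrow> real \<Rightarrow> 'a \<Rightarrow> 'e" where
  "step_integral W ps t \<omega> = (\<Sum>(c, d, \<eta>) \<leftarrow> ps. (W (min d t) \<omega> - W (min c t) \<omega>) *\<^sub>R \<eta> \<omega>)"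

text \<open>
  Processes on \<open>[0,T]\<close> to which the definition of stochastic integrability applies. Since \<open>\<phi>\<close> is
  jointly strongly measurable, \<open>\<langle>\<phi>,x\<^sup>*\<rangle> \<in> L\<^sup>0(\<Omega>;L\<^sup>2(0,T))\<close> says that almost all paths of \<open>\<langle>\<phi>,x\<^sup>*\<rangle>\<close>
  are square integrable.
\<close>

definition admissible_integrand ::
    "'a measure \<Rightarrow> (real \<Rightarrow> 'a measure) \<Rightarrow> real \<Rightarrow> (real \<Rightarrow> 'a \<Rightarrow> 'e::real_normed_vector) \<Rightarrow> bool" where
  "admissible_integrand M F T \<phi> \<longleftrightarrow>
     strongly_measurable (restrict_space borel {0..T} \<Otimes>\<^sub>M M) (\<lambda>(t, \<omega>). \<phi> t \<omega>) \<and>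
     (\<forall>t\<in>{0..T}. strongly_measurable (F t) (\<phi> t)) \<and>
     (\<forall>x :: 'e \<Rightarrow>\<^sub>L real. AE \<omega> in M. sqnorm_L2 T (\<lambda>t. blinfun_apply x (\<phi> t \<omega>)) < \<infinity>)"

text \<open>
  \<open>\<phi>\<close> is stochastically integrable on \<open>[0,T]\<close> with integral process (a representative of) \<open>\<zeta>\<close>. That
  \<open>\<zeta>\<close> belongs to \<open>L\<^sup>0(\<Omega>;C\<^sub>b([0,T];E))\<close> is expressed by continuity of its paths and strong
  measurability of each \<open>\<zeta> t\<close>; for separable \<open>E\<close> this is strong measurability of the
  \<open>C\<^sub>b([0,T];E)\<close>-valued map.
\<close>

definition has_stoch_integral ::
    "'a measure \<Rightarrow> (real \<Rightarrow> 'a measure) \<Rightarrow> (real \<Rightarrow> 'a \<Rightarrow> real) \<Rightarrow> real \<Rightarrow>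
     (real \<Rightarrow> 'a \<Rightarrow> 'e::real_normed_vector) \<Rightarrow> (real \<Rightarrow> 'a \<Rightarrow> 'e) \<Rightarrow> bool" where
  "has_stoch_integral M F W T \<phi> \<zeta> \<longleftrightarrow>
     admissible_integrand M F T \<phi> \<and>
     (\<forall>t\<in>{0..T}. strongly_measurable M (\<zeta> t)) \<and>
     (\<forall>\<omega>\<in>space M. continuous_on {0..T} (\<lambda>t. \<zeta> t \<omega>)) \<and>
     (\<exists>ps :: nat \<Rightarrow> (real \<times> real \<times> ('a \<Rightarrow> 'e)) list.
        (\<forall>n. adapted_step F T (ps n)) \<and>
        (\<forall>x :: 'e \<Rightarrow>\<^sub>L real.
           tendsto_L0 M (dist_L2 T)
             (\<lambda>n \<omega> t. blinfun_apply x (step_process (ps n) t \<omega>)) (\<lambda>\<omega> t. blinfun_apply x (\<phi> t \<omega>))) \<and>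
        tendsto_L0 M (dist_C T) (\<lambda>n \<omega> t. step_integral W (ps n) t \<omega>) (\<lambda>\<omega> t. \<zeta> t \<omega>))"

definition stoch_integrable ::
    "'a measure \<Rightarrow> (real \<Rightarrow> 'a measure) \<Rightarrow> (real \<Rightarrow> 'a \<Rightarrow> real) \<Rightarrow> real \<Rightarrow>
     (real \<Rightarrow> 'a \<Rightarrow> 'e::real_normed_vector) \<Rightarrow> bool" where
  "stoch_integrable M F W T \<phi> \<longleftrightarrow> (\<exists>\<zeta>. has_stoch_integral M F W T \<phi> \<zeta>)"

definition locally_stoch_integrable ::
    "'a measure \<Rightarrow> (real \<Rightarrow> 'a measure) \<Rightarrow> (real \<Rightarrow> 'a \<Rightarrow> real) \<Rightarrow>
     (real \<Rightarrow> 'a \<Rightarrow> 'e::real_normed_vector) \<Rightarrow> bool" where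
  "locally_stoch_integrable M F W \<phi> \<longleftrightarrow> (\<forall>T>0. stoch_integrable M F W T \<phi>)"

definition integral_process ::
    "'a measure \<Rightarrow> (real \<Rightarrow> 'a measure) \<Rightarrow> (real \<Rightarrow> 'a \<Rightarrow> real) \<Rightarrow>
     (real \<Rightarrow> 'a \<Rightarrow> 'e::real_normed_vector) \<Rightarrow> (real \<Rightarrow> 'a \<Rightarrow> 'e) \<Rightarrow> bool" where
  "integral_process M F W \<phi> \<zeta> \<longleftrightarrow>
     (\<forall>\<omega>\<in>space M. continuous_on {0..} (\<lambda>t. \<zeta> t \<omega>)) \<and>
     (\<forall>T>0. has_stoch_integral M F W T \<phi> \<zeta>)"

end

theory Submission
  imports Defs
begin

text \<open>
  For \<open>\<F>\<^sub>s\<close>-measurable \<open>\<eta>\<close> and \<open>t > s\<close>, an adapted step process on \<open>(s,t]\<close> can be found whose stochastic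
  integral is close to \<open>\<eta>\<close> in probability: cut \<open>(s,t]\<close> into \<open>N\<close> equal pieces and on each piece stake
  one tenth of the fraction still missing on the normalised Brownian increment. The missing fraction after
  \<open>N\<close> bets is \<open>D\<^sub>N = \<Prod>\<^sub>i (1 - Z\<^sub>i / 10)\<close> with independent standard normal \<open>Z\<^sub>i\<close>, and \<open>E \<bar>D\<^sub>N\<bar>\<^bsup>1/2\<^esup> = r\<^sup>N\<close> for
  some \<open>r < 1\<close>, so \<open>D\<^sub>N \<rightarrow> 0\<close> in probability.

  As \<open>\<F>\<^sub>\<infinity>\<close> is countably generated modulo null sets, \<open>L\<^sup>0(\<F>\<^sub>\<infinity>;E)\<close> has a countable dense set of step
  functions, each measurable for some \<open>\<F>\<^sub>n\<close>. List them as targets \<open>\<tau>\<^sub>n\<close>, with infinite repetition, such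
  that \<open>\<tau>\<^sub>n\<close> is \<open>\<F>\<^sub>n\<close>-measurable, and on \<open>(n,n+1]\<close> steer the integral from \<open>\<zeta>(n)\<close> to within \<open>1/(n+1)\<close> of
  \<open>\<tau>\<^sub>n\<close> in probability. The resulting integrand is an adapted step process on every bounded interval, so it is trivially
  locally stochastically integrable.
\<close>

text \<open>The square root is concave, so at \<open>1 - u\<close> with centred small \<open>u\<close> it loses a multiple of \<open>u\<^sup>2\<close> in
  expectation; the quartic term only pays for large \<open>u\<close>.\<close>

lemma sqrt_abs_one_minus_le:
  fixes u :: real
  shows "sqrt \<bar>1 - u\<bar> \<le> 1 - u / 2 - u\<^sup>2 / 16 + u ^ 4"
proof (cases "u \<le> 1")
  case True
  define y where "y = sqrt (1 - u)"
  have y: "0 \<le> y" "u = 1 - y\<^sup>2" using True by (auto simp: y_def)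
  \<comment> \<open>With \<open>u = 1 - y^2\<close> both sides agree to second order at
    \<open>y = 1\<close>, so the difference of the two sides is \<open>(1 - y)^2 * b\<close>; only
    the sign of \<open>b\<close> remains.\<close>
  define b where "b = 1/2 - (1 + y)\<^sup>2 / 16 + (1 - y)\<^sup>2 * (1 + y) ^ 4"
  have "0 \<le> b"
  \<comment> \<open>Up to 3/2 the subtracted square is at most 25/64, below the constant 1/2. Beyond
    that, the quartic term is at least \<open>(1 + y)^2 / 4\<close> and absorbs it.\<close>
  proof (cases "y \<le> 3/2")
    case True
    have "(1 + y)\<^sup>2 \<le> (5/2)\<^sup>2" using y True by (intro power_mono) auto
    moreover have "0 \<le> (1 - y)\<^sup>2 * (1 + y) ^ 4" by simp
    ultimately show ?thesis by (simp add: b_def power2_eq_square)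
  next
    case False
    have "(1/2)\<^sup>2 \<le> (y - 1)\<^sup>2" using False by (intro power_mono) auto
    hence 1: "1/4 \<le> (1 - y)\<^sup>2" by (simp add: power2_eq_square algebra_simps)
    have 2: "(1 + y)\<^sup>2 \<le> (1 + y) ^ 4" using y by (intro power_increasing) auto
    have "1/4 * (1 + y)\<^sup>2 \<le> (1 - y)\<^sup>2 * (1 + y) ^ 4" by (intro mult_mono 1 2) auto
    moreover have "0 \<le> (1 + y)\<^sup>2" by simp
    ultimately show ?thesis unfolding b_def by linarith
  qed
  hence "0 \<le> (1 - y)\<^sup>2 * b" by simp
  also have "(1 - y)\<^sup>2 * b = 1 - u / 2 - u\<^sup>2 / 16 + u ^ 4 - y"
    unfolding b_def y(2) by (simp add: field_simps power2_eq_square power4_eq_xxxx)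
  also have "y = sqrt \<bar>1 - u\<bar>" using True by (simp add: y_def)
  finally show ?thesis by simp
next
  case False
  define v w where "v = u\<^sup>2" and "w = u ^ 4"
  have "sqrt (u - 1) \<le> u / 2" using arith_geo_mean_sqrt[of 1 "u - 1"] False by simp
  moreover have "v \<le> w" using False unfolding v_def w_def by (intro power_increasing) auto
  \<comment> \<open>After bounding the root by \<open>u / 2\<close> and \<open>u^4\<close> from
    below by \<open>u^2\<close>, the claim reduces to \<open>u \<le> 1 + 15 * u^2 / 16\<close>; this
    is its sum-of-squares form.\<close>
  moreover have "0 \<le> (u / 2 - 1)\<^sup>2 + 11 * u\<^sup>2 / 16" by simp
  hence "u \<le> 1 + 15 * v / 16" by (simp add: v_def power2_eq_square field_simps)
  ultimately have "sqrt (u - 1) \<le> 1 - u / 2 - v / 16 + w" by linarith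
  thus ?thesis using False by (simp add: v_def w_def)
qed

text \<open>With \<open>u = Z / 10\<close>, \<open>Z\<close> standard normal, the previous bound has expectation
  \<open>1 - 1/1600 + 3/10000 = 39987/40000\<close>.\<close>

lemma (in prob_space) normal_sqrt_moment:
  fixes X :: "'a \<Rightarrow> real"
  assumes X: "distributed M lborel X (normal_density 0 \<sigma>)" and \<sigma>: "0 < \<sigma>"
  shows "integrable M (\<lambda>\<omega>. sqrt \<bar>1 - X \<omega> / (10 * \<sigma>)\<bar>)" (is ?int)
    and "expectation (\<lambda>\<omega>. sqrt \<bar>1 - X \<omega> / (10 * \<sigma>)\<bar>) \<le> 39987 / 40000" (is ?le)
proof -
  define p :: "real \<Rightarrow> real" where "p u = 1 - u / 2 - u\<^sup>2 / 16 + u ^ 4" for u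
  define f where "f x = normal_density 0 \<sigma> x * sqrt \<bar>1 - x / (10 * \<sigma>)\<bar>" for x
  have m [measurable]: "(\<lambda>x. sqrt \<bar>1 - x / (10 * \<sigma>)\<bar>) \<in> borel_measurable lborel" by measurable
  have m' [measurable]: "X \<in> borel_measurable M" using X by (simp add: distributed_def)
  have b0: "has_bochner_integral lborel (\<lambda>x. normal_density 0 \<sigma> x) 1"
    using normal_moment_even[OF \<sigma>, of 0 0] by simp
  have b1: "has_bochner_integral lborel (\<lambda>x. normal_density 0 \<sigma> x * x) 0"
    using normal_moment_odd[OF \<sigma>, of 0 0] by simp
  have b2: "has_bochner_integral lborel (\<lambda>x. normal_density 0 \<sigma> x * x\<^sup>2) (\<sigma>\<^sup>2)"
    using normal_moment_even[OF \<sigma>, of 0 1] by simp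
  have b4: "has_bochner_integral lborel (\<lambda>x. normal_density 0 \<sigma> x * x ^ 4) (3 * \<sigma> ^ 4)"
    using normal_moment_even[OF \<sigma>, of 0 2] by (simp add: fact_numeral power2_eq_square power4_eq_xxxx mult.assoc)
  \<comment> \<open>This is \<open>p (x / (10 * \<sigma>))\<close> multiplied out against the
    density, so that the moments 1, 0, \<open>\<sigma>^2\<close> and \<open>3 * \<sigma>^4\<close>
    can be inserted termwise.\<close>
  have "has_bochner_integral lborel
     (\<lambda>x. normal_density 0 \<sigma> x - normal_density 0 \<sigma> x * x * (1 / (20 * \<sigma>))
        - normal_density 0 \<sigma> x * x\<^sup>2 * (1 / (1600 * \<sigma>\<^sup>2))
        + normal_density 0 \<sigma> x * x ^ 4 * (1 / (10000 * \<sigma> ^ 4)))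
     (1 - 0 * (1 / (20 * \<sigma>)) - \<sigma>\<^sup>2 * (1 / (1600 * \<sigma>\<^sup>2)) + 3 * \<sigma> ^ 4 * (1 / (10000 * \<sigma> ^ 4)))"
    by (intro has_bochner_integral_add has_bochner_integral_diff has_bochner_integral_mult_left b0 b1 b2 b4)
  also have "(1 - 0 * (1 / (20 * \<sigma>)) - \<sigma>\<^sup>2 * (1 / (1600 * \<sigma>\<^sup>2)) + 3 * \<sigma> ^ 4 * (1 / (10000 * \<sigma> ^ 4)))
     = 39987 / 40000" using \<sigma> by simp
  also have "(\<lambda>x. normal_density 0 \<sigma> x - normal_density 0 \<sigma> x * x * (1 / (20 * \<sigma>))
        - normal_density 0 \<sigma> x * x\<^sup>2 * (1 / (1600 * \<sigma>\<^sup>2))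
        + normal_density 0 \<sigma> x * x ^ 4 * (1 / (10000 * \<sigma> ^ 4)))
      = (\<lambda>x. normal_density 0 \<sigma> x * p (x / (10 * \<sigma>)))"
    by (auto simp: p_def algebra_simps power_divide power_mult_distrib)
  finally have bp: "has_bochner_integral lborel (\<lambda>x. normal_density 0 \<sigma> x * p (x / (10 * \<sigma>))) (39987 / 40000)" .
  have le: "f x \<le> normal_density 0 \<sigma> x * p (x / (10 * \<sigma>))" for x
    unfolding f_def p_def by (intro mult_left_mono sqrt_abs_one_minus_le) simp
  have pos: "0 \<le> f x" for x unfolding f_def by simp
  have intf: "integrable lborel f"
  proof (rule Bochner_Integration.integrable_bound[OF integrable.intros[OF bp]])
    show "f \<in> borel_measurable lborel" unfolding f_def by measurable
    show "AE x in lborel. norm (f x) \<le> norm (normal_density 0 \<sigma> x * p (x / (10 * \<sigma>)))"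
      using le pos by (auto intro!: AE_I2 simp del: abs_mult) (meson abs_ge_self order_trans)
  qed
  show ?int using distributed_integrable[OF X m] intf unfolding f_def by simp
  have "expectation (\<lambda>\<omega>. sqrt \<bar>1 - X \<omega> / (10 * \<sigma>)\<bar>) = integral\<^sup>L lborel f"
    using distributed_integral[OF X m] unfolding f_def by simp
  also have "\<dots> \<le> 39987 / 40000"
    using integral_mono[OF intf integrable.intros[OF bp] le]
    by (simp add: has_bochner_integral_integral_eq[OF bp])
  finally show ?le .
qed

section \<open>Steering a stochastic integral to a target\<close>

text \<open>Tightness of a single random variable: the events that the norm exceeds \<open>k\<close>
  decrease to the empty set.\<close>

lemma (in prob_space) exists_prob_norm_gt_less:
  fixes \<eta> :: "'a \<Rightarrow> 'e::{real_normed_vector, second_countable_topology}"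
  assumes [measurable]: "\<eta> \<in> borel_measurable M" and "0 < \<epsilon>"
  shows "\<exists>K>0. prob {\<omega>\<in>space M. K < norm (\<eta> \<omega>)} < \<epsilon>"
proof -
  let ?A = "\<lambda>k::nat. {\<omega>\<in>space M. real k < norm (\<eta> \<omega>)}"
  have "(\<lambda>k. prob (?A k)) \<longlonglongrightarrow> prob (\<Inter>k. ?A k)"
    by (rule finite_Lim_measure_decseq) (auto simp: decseq_def)
  moreover have "(\<Inter>k. ?A k) = {}"
  proof -
    have "\<exists>k::nat. \<not> real k < norm (\<eta> \<omega>)" for \<omega>
      using reals_Archimedean2[of "norm (\<eta> \<omega>)"] by (meson less_asym)
    thus ?thesis by blast
  qed
  ultimately have "(\<lambda>k. prob (?A k)) \<longlonglongrightarrow> 0" by simp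
  hence "eventually (\<lambda>k. prob (?A k) < \<epsilon>) sequentially"
    using assms(2) by (rule order_tendstoD)
  moreover have "eventually (\<lambda>k::nat. k > 0) sequentially" by (rule eventually_gt_at_top)
  ultimately have "eventually (\<lambda>k. prob (?A k) < \<epsilon> \<and> k > 0) sequentially" by eventually_elim simp
  then obtain k where "prob (?A k) < \<epsilon>" "k > 0" by (auto simp: eventually_sequentially)
  thus ?thesis by (intro exI[of _ "real k"]) auto
qed

section \<open>Brownian increments and repeated betting\<close>

locale filtered_brownian_motion = prob_space M for M :: "'a measure" +
  fixes F :: "real \<Rightarrow> 'a measure" and W :: "real \<Rightarrow> 'a \<Rightarrow> real"
  assumes filtration: "complete_filtration M F" and brownian: "brownian_motion M F W"
begin

lemma subalgebra_F: "0 \<le> t \<Longrightarrow> subalgebra M (F t)"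
  using filtration by (simp add: complete_filtration_def)

lemma space_F [simp]: "0 \<le> t \<Longrightarrow> space (F t) = space M"
  using subalgebra_F by (simp add: subalgebra_def)

lemma subalgebra_F_mono: "0 \<le> s \<Longrightarrow> s \<le> t \<Longrightarrow> subalgebra (F t) (F s)"
  using filtration by (auto simp: complete_filtration_def subalgebra_def)

lemma measurable_F_mono:
  "f \<in> borel_measurable (F s) \<Longrightarrow> 0 \<le> s \<Longrightarrow> s \<le> t \<Longrightarrow> f \<in> borel_measurable (F t)"
  using measurable_from_subalg subalgebra_F_mono by blast

lemma measurable_F_M: "f \<in> borel_measurable (F s) \<Longrightarrow> 0 \<le> s \<Longrightarrow> f \<in> borel_measurable M"
  using measurable_from_subalg subalgebra_F by blast

lemma W_measurable_F: "0 \<le> t \<Longrightarrow> W t \<in> borel_measurable (F t)"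
  using brownian by (simp add: brownian_motion_def)

lemma W_measurable [measurable]: "0 \<le> t \<Longrightarrow> W t \<in> borel_measurable M"
  using W_measurable_F measurable_F_M by blast

lemma W_increment_distributed:
  "0 \<le> s \<Longrightarrow> s < t \<Longrightarrow> distributed M lborel (\<lambda>\<omega>. W t \<omega> - W s \<omega>) (normal_density 0 (sqrt (t - s)))"
  using brownian by (simp add: brownian_motion_def)

text \<open>Independence of the increment from all of \<open>F s\<close> restricts to the smaller
  sigma-algebra generated by \<open>X\<close>.\<close>

lemma W_increment_indep:
  fixes X :: "'a \<Rightarrow> real"
  assumes st: "0 \<le> s" "s < t" and X: "X \<in> borel_measurable (F s)"
  shows "indep_var borel X borel (\<lambda>\<omega>. W t \<omega> - W s \<omega>)"
proof -
  have ind: "indep_set (sets (F s)) (sets (vimage_algebra (space M) (\<lambda>\<omega>. W t \<omega> - W s \<omega>) borel))"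
    using brownian st by (simp add: brownian_motion_def)
  have "{X -` A \<inter> space M |A. A \<in> sets borel} \<subseteq> sets (F s)"
    using measurable_sets[OF X] st by auto
  hence 1: "sigma_sets (space M) {X -` A \<inter> space M |A. A \<in> sets borel} \<subseteq> sets (F s)"
    using sets.sigma_sets_subset[of _ "F s"] st by simp
  have 2: "sigma_sets (space M) {(\<lambda>\<omega>. W t \<omega> - W s \<omega>) -` A \<inter> space M |A. A \<in> sets borel}
      = sets (vimage_algebra (space M) (\<lambda>\<omega>. W t \<omega> - W s \<omega>) borel)"
    unfolding vimage_algebra_def by (rule sets_measure_of[symmetric]) auto
  have "indep_set (sigma_sets (space M) {X -` A \<inter> space M |A. A \<in> sets borel})
     (sigma_sets (space M) {(\<lambda>\<omega>. W t \<omega> - W s \<omega>) -` A \<inter> space M |A. A \<in> sets borel})"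
    unfolding 2 using ind 1 by (auto simp: indep_sets2_eq)
  moreover have "X \<in> borel_measurable M" "(\<lambda>\<omega>. W t \<omega> - W s \<omega>) \<in> borel_measurable M"
    using measurable_F_M[OF X] st by auto
  ultimately show ?thesis by (simp add: indep_var_eq)
qed

text \<open>The fraction of the target that is still missing after \<open>i\<close> bets, each of which stakes a fixed
  multiple of what is missing on the next Brownian increment.\<close>

primrec residual :: "real \<Rightarrow> real \<Rightarrow> nat \<Rightarrow> 'a \<Rightarrow> real" where
  "residual s \<delta> 0 \<omega> = 1"
| "residual s \<delta> (Suc i) \<omega> = residual s \<delta> i \<omega> *
     (1 - (W (s + real (Suc i) * \<delta>) \<omega> - W (s + real i * \<delta>) \<omega>) / (10 * sqrt \<delta>))"

text \<open>Dividing by \<open>sqrt \<delta>\<close> normalises the increment to a standard normal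
  \<open>Z\<close>; the bet then adds \<open>residual * Z / 10\<close> times \<open>\<eta>\<close>
  to the integral, which is exactly what the recursion for \<open>residual\<close> removes from the
  missing part.\<close>

definition betting_steps ::
  "real \<Rightarrow> real \<Rightarrow> ('a \<Rightarrow> 'e) \<Rightarrow> nat \<Rightarrow> (real \<times> real \<times> ('a \<Rightarrow> 'e::real_normed_vector)) list" where
  "betting_steps s \<delta> \<eta> N = map (\<lambda>i. (s + real i * \<delta>, s + real (Suc i) * \<delta>,
     \<lambda>\<omega>. (residual s \<delta> i \<omega> / (10 * sqrt \<delta>)) *\<^sub>R \<eta> \<omega>)) [0..<N]"

lemma residual_measurable:
  assumes "0 \<le> s" "0 < \<delta>"
  shows "residual s \<delta> i \<in> borel_measurable (F (s + real i * \<delta>))"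
proof (induction i)
  case (Suc i)
  let ?u = "s + real i * \<delta>" and ?v = "s + real (Suc i) * \<delta>"
  have uv: "0 \<le> ?u" "?u \<le> ?v" using assms by (auto simp: algebra_simps)
  have [measurable]: "residual s \<delta> i \<in> borel_measurable (F ?v)" "W ?u \<in> borel_measurable (F ?v)"
      "W ?v \<in> borel_measurable (F ?v)"
    using measurable_F_mono[OF _ uv] Suc W_measurable_F uv by auto
  show ?case unfolding residual.simps by measurable
qed simp

text \<open>The residual is known before the next increment, which is independent of it, so the
  expectations multiply. The half moment is used because the mean of the residual itself stays equal
  to 1.\<close>

lemma residual_sqrt_moment:
  assumes "0 \<le> s" "0 < \<delta>"
  shows "integrable M (\<lambda>\<omega>. sqrt \<bar>residual s \<delta> i \<omega>\<bar>) \<and>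
    expectation (\<lambda>\<omega>. sqrt \<bar>residual s \<delta> i \<omega>\<bar>) \<le> (39987 / 40000) ^ i"
proof (induction i)
  case (Suc i)
  let ?u = "s + real i * \<delta>" and ?v = "s + real (Suc i) * \<delta>"
  let ?D = "\<lambda>\<omega>. W ?v \<omega> - W ?u \<omega>"
  let ?X = "\<lambda>\<omega>. sqrt \<bar>residual s \<delta> i \<omega>\<bar>" and ?Y = "\<lambda>\<omega>. sqrt \<bar>1 - ?D \<omega> / (10 * sqrt \<delta>)\<bar>"
  have uv: "0 \<le> ?u" "?u < ?v" using assms by (auto simp: algebra_simps)
  have D: "distributed M lborel ?D (normal_density 0 (sqrt \<delta>))"
    using W_increment_distributed[OF uv] by (simp add: algebra_simps)
  note Y = normal_sqrt_moment[OF D, unfolded real_sqrt_gt_0_iff, OF assms(2)]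
  have "indep_var borel ((\<lambda>x. sqrt \<bar>x\<bar>) \<circ> residual s \<delta> i) borel ((\<lambda>x. sqrt \<bar>1 - x / (10 * sqrt \<delta>)\<bar>) \<circ> ?D)"
    by (rule indep_var_compose[OF W_increment_indep[OF uv residual_measurable[OF assms]]]) measurable
  hence ind: "indep_var borel ?X borel ?Y" by (simp add: o_def)
  have eq: "sqrt \<bar>residual s \<delta> (Suc i) \<omega>\<bar> = ?X \<omega> * ?Y \<omega>" for \<omega>
    by (simp add: abs_mult real_sqrt_mult)
  have "integrable M (\<lambda>\<omega>. ?X \<omega> * ?Y \<omega>)"
    using indep_var_integrable[OF ind] Suc Y by simp
  moreover have "expectation (\<lambda>\<omega>. ?X \<omega> * ?Y \<omega>) = expectation ?X * expectation ?Y"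
    using indep_var_lebesgue_integral[OF ind] Suc Y by simp
  moreover have "expectation ?X * expectation ?Y \<le> (39987 / 40000) ^ i * (39987 / 40000)"
    using Suc Y by (intro mult_mono) auto
  ultimately show ?case unfolding eq by simp
qed (simp add: prob_space)

text \<open>The gains telescope: each bet contributes the difference of two successive residuals,
  times \<open>\<eta>\<close>. At times after the last bet every \<open>min\<close> returns the end
  of its interval.\<close>

lemma step_integral_betting_steps:
  assumes "0 < \<delta>" "s + real N * \<delta> \<le> t"
  shows "step_integral W (betting_steps s \<delta> \<eta> N) t \<omega> = (1 - residual s \<delta> N \<omega>) *\<^sub>R \<eta> \<omega>"
  using assms(2)
proof (induction N)
  case 0
  show ?case by (simp add: step_integral_def betting_steps_def)
next
  case (Suc N)
  have le: "s + real N * \<delta> \<le> t" using Suc.prems assms by (simp add: algebra_simps)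
  have "step_integral W (betting_steps s \<delta> \<eta> (Suc N)) t \<omega>
      = step_integral W (betting_steps s \<delta> \<eta> N) t \<omega>
        + ((W (s + real (Suc N) * \<delta>) \<omega> - W (s + real N * \<delta>) \<omega>) * (residual s \<delta> N \<omega> / (10 * sqrt \<delta>))) *\<^sub>R \<eta> \<omega>"
    using Suc.prems le by (simp add: step_integral_def betting_steps_def min_absorb1)
  also have "\<dots> = (1 - residual s \<delta> (Suc N) \<omega>) *\<^sub>R \<eta> \<omega>"
    unfolding Suc.IH[OF le] scaleR_add_left[symmetric] residual.simps
    by (intro arg_cong2[where f = scaleR] refl) (simp add: field_simps)
  finally show ?case .
qed

lemma adapted_betting_steps:
  fixes \<eta> :: "'a \<Rightarrow> 'e::{real_normed_vector, second_countable_topology}"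
  assumes "0 \<le> s" "0 < \<delta>" "s + real N * \<delta> \<le> t" "\<eta> \<in> borel_measurable (F s)"
  shows "adapted_step F t (betting_steps s \<delta> \<eta> N)"
proof -
  have "0 \<le> s + real i * \<delta> \<and> s + real i * \<delta> < s + real (Suc i) * \<delta> \<and> s + real (Suc i) * \<delta> \<le> t \<and>
      strongly_measurable (F (s + real i * \<delta>)) (\<lambda>\<omega>. (residual s \<delta> i \<omega> / (10 * sqrt \<delta>)) *\<^sub>R \<eta> \<omega>)"
    if "i < N" for i
  proof (intro conjI)
    show 0: "0 \<le> s + real i * \<delta>" "s + real i * \<delta> < s + real (Suc i) * \<delta>"
      using assms by (auto simp: algebra_simps)
    have "real (Suc i) * \<delta> \<le> real N * \<delta>" using assms that by (intro mult_right_mono) auto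
    thus "s + real (Suc i) * \<delta> \<le> t" using assms(3) by linarith
    have [measurable]: "residual s \<delta> i \<in> borel_measurable (F (s + real i * \<delta>))"
      "\<eta> \<in> borel_measurable (F (s + real i * \<delta>))"
      using residual_measurable[OF assms(1,2)] measurable_F_mono[OF assms(4,1)] assms by auto
    show "strongly_measurable (F (s + real i * \<delta>)) (\<lambda>\<omega>. (residual s \<delta> i \<omega> / (10 * sqrt \<delta>)) *\<^sub>R \<eta> \<omega>)"
      unfolding strongly_measurable_iff_borel by measurable
  qed
  thus ?thesis unfolding adapted_step_def betting_steps_def by auto
qed

text \<open>The error is \<open>\<bar>R\<bar> * norm \<eta>\<close>: the norm is bounded by
  \<open>K\<close> with high probability, and \<open>R\<close> is small by Markov's inequality for
  its square root. Steps starting no earlier than \<open>s\<close> can be appended to a list that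
  ends at \<open>s\<close> without altering the past.\<close>

lemma step_integral_approximates:
  fixes \<eta> :: "'a \<Rightarrow> 'e::{real_normed_vector, second_countable_topology}"
  assumes st: "0 \<le> s" "s < t" and \<eta>: "\<eta> \<in> borel_measurable (F s)" and \<epsilon>: "0 < \<epsilon>"
  shows "\<exists>ps. adapted_step F t ps \<and> (\<forall>(c, d, \<xi>)\<in>set ps. s \<le> c) \<and>
    prob {\<omega>\<in>space M. \<epsilon> < dist (step_integral W ps t \<omega>) (\<eta> \<omega>)} < \<epsilon>"
proof -
  have \<eta>M [measurable]: "\<eta> \<in> borel_measurable M" using measurable_F_M[OF \<eta>] st by simp
  obtain K where K: "0 < K" "prob {\<omega>\<in>space M. K < norm (\<eta> \<omega>)} < \<epsilon> / 2"
    using exists_prob_norm_gt_less[OF \<eta>M, of "\<epsilon> / 2"] \<epsilon> by auto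
  define r :: real where "r = 39987 / 40000"
  have r: "0 \<le> r" "r < 1" by (auto simp: r_def)
  \<comment> \<open>Chosen so that \<open>sqrt \<bar>R\<bar> < c\<close> and
    \<open>norm \<eta> \<le> K\<close> together keep the error at most
    \<open>\<epsilon>\<close>.\<close>
  define c where "c = sqrt (\<epsilon> / K)"
  have c: "0 < c" using K \<epsilon> by (simp add: c_def)
  have "(\<lambda>i. r ^ i) \<longlonglongrightarrow> 0" by (rule LIMSEQ_realpow_zero[OF r])
  \<comment> \<open>This number of bets brings the Markov bound \<open>r ^ N / c\<close> below
    \<open>\<epsilon> / 2\<close>; \<open>N > 0\<close> allows division by \<open>N\<close> in the
    mesh \<open>\<delta>\<close>.\<close>
  hence "eventually (\<lambda>i. r ^ i < c * (\<epsilon> / 2)) sequentially"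
    using c \<epsilon> by (intro order_tendstoD) auto
  moreover have "eventually (\<lambda>i::nat. i > 0) sequentially" by (rule eventually_gt_at_top)
  ultimately have "eventually (\<lambda>i. r ^ i < c * (\<epsilon> / 2) \<and> i > 0) sequentially"
    by eventually_elim simp
  then obtain N where N: "r ^ N < c * (\<epsilon> / 2)" "N > 0"
    by (auto simp: eventually_sequentially)
  define \<delta> where "\<delta> = (t - s) / N"
  have \<delta>: "0 < \<delta>" "s + real N * \<delta> = t" using st N by (auto simp: \<delta>_def)
  define ps where "ps = betting_steps s \<delta> \<eta> N"
  define R where "R = residual s \<delta> N"
  have Rm [measurable]: "R \<in> borel_measurable M"
    unfolding R_def using residual_measurable[OF st(1) \<delta>(1), of N] \<delta> st by (intro measurable_F_M[of _ t]) auto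
  have R: "integrable M (\<lambda>\<omega>. sqrt \<bar>R \<omega>\<bar>)" "expectation (\<lambda>\<omega>. sqrt \<bar>R \<omega>\<bar>) \<le> r ^ N"
    using residual_sqrt_moment[OF st(1) \<delta>(1), of N] unfolding R_def r_def by blast+
  have "prob {\<omega>\<in>space M. c \<le> sqrt \<bar>R \<omega>\<bar>} \<le> expectation (\<lambda>\<omega>. sqrt \<bar>R \<omega>\<bar>) / c"
    by (rule integral_Markov_inequality_measure[where A = "space M", OF R(1)]) (use c in auto)
  also have "\<dots> \<le> r ^ N / c" using R c by (intro divide_right_mono) auto
  also have "\<dots> < \<epsilon> / 2" using N c by (simp add: pos_divide_less_eq mult.commute)
  finally have P: "prob {\<omega>\<in>space M. c \<le> sqrt \<bar>R \<omega>\<bar>} < \<epsilon> / 2" .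
  have dist_eq: "dist (step_integral W ps t \<omega>) (\<eta> \<omega>) = \<bar>R \<omega>\<bar> * norm (\<eta> \<omega>)" for \<omega>
    unfolding ps_def step_integral_betting_steps[OF \<delta>(1) eq_refl[OF \<delta>(2)]] R_def
    by (simp add: dist_norm scaleR_left_diff_distrib)
  have "K < norm (\<eta> \<omega>) \<or> c \<le> sqrt \<bar>R \<omega>\<bar>" if "\<epsilon> < \<bar>R \<omega>\<bar> * norm (\<eta> \<omega>)" for \<omega>
  proof (rule ccontr)
    assume "\<not> (K < norm (\<eta> \<omega>) \<or> c \<le> sqrt \<bar>R \<omega>\<bar>)"
    hence "norm (\<eta> \<omega>) \<le> K" "\<bar>R \<omega>\<bar> \<le> \<epsilon> / K" by (auto simp: c_def)
    hence "\<bar>R \<omega>\<bar> * norm (\<eta> \<omega>) \<le> \<epsilon> / K * K" using K \<epsilon> by (intro mult_mono) auto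
    thus False using that K by simp
  qed
  hence "{\<omega>\<in>space M. \<epsilon> < \<bar>R \<omega>\<bar> * norm (\<eta> \<omega>)} \<subseteq>
     {\<omega>\<in>space M. K < norm (\<eta> \<omega>)} \<union> {\<omega>\<in>space M. c \<le> sqrt \<bar>R \<omega>\<bar>}"
    by blast
  hence "prob {\<omega>\<in>space M. \<epsilon> < \<bar>R \<omega>\<bar> * norm (\<eta> \<omega>)} \<le>
     prob ({\<omega>\<in>space M. K < norm (\<eta> \<omega>)} \<union> {\<omega>\<in>space M. c \<le> sqrt \<bar>R \<omega>\<bar>})"
    by (intro finite_measure_mono) measurable
  also have "\<dots> \<le> prob {\<omega>\<in>space M. K < norm (\<eta> \<omega>)} + prob {\<omega>\<in>space M. c \<le> sqrt \<bar>R \<omega>\<bar>}"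
    by (intro measure_Un_le) measurable
  also have "\<dots> < \<epsilon>" using K P by linarith
  finally have "prob {\<omega>\<in>space M. \<epsilon> < dist (step_integral W ps t \<omega>) (\<eta> \<omega>)} < \<epsilon>"
    by (simp add: dist_eq)
  moreover have "adapted_step F t ps"
    unfolding ps_def using st \<delta> \<eta> by (intro adapted_betting_steps) auto
  moreover have "\<forall>(c, d, \<xi>)\<in>set ps. s \<le> c"
    using \<delta> by (auto simp: ps_def betting_steps_def)
  ultimately show ?thesis by blast
qed

end

section \<open>A countable dense set of targets\<close>

text \<open>Each stage \<open>L (Suc n)\<close> adds the complements and pairwise unions of stage
  \<open>n\<close>. All stages stay countable, and since they increase, two sets of the union
  already lie in a common stage.\<close>

lemma countable_algebra_containing:
  assumes C: "countable C" "C \<subseteq> Pow \<Omega>"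
  obtains A where "countable A" "C \<subseteq> A" "algebra \<Omega> A" "A \<subseteq> sigma_sets \<Omega> C"
proof -
  define L where "L = rec_nat (insert {} C) (\<lambda>_ X. X \<union> (\<lambda>a. \<Omega> - a) ` X \<union> (\<lambda>(a, b). a \<union> b) ` (X \<times> X))"
  have L0: "L 0 = insert {} C"
    and LS: "L (Suc n) = L n \<union> (\<lambda>a. \<Omega> - a) ` L n \<union> (\<lambda>(a, b). a \<union> b) ` (L n \<times> L n)" for n
    by (simp_all add: L_def)
  have mono: "L m \<subseteq> L n" if "m \<le> n" for m n
    by (rule lift_Suc_mono_le[OF _ that]) (auto simp: LS)
  have cnt: "countable (L n)" for n
    by (induction n) (auto simp: L0 LS C(1))
  have sub: "L n \<subseteq> sigma_sets \<Omega> C" for n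
  proof (induction n)
    case 0
    show ?case by (auto simp: L0 intro: sigma_sets.Empty sigma_sets.Basic)
  next
    case (Suc n)
    thus ?case by (auto simp: LS intro: sigma_sets.Compl sigma_sets_Un)
  qed
  have Pow: "sigma_sets \<Omega> C \<subseteq> Pow \<Omega>" using sigma_sets_into_sp[OF C(2)] by blast
  have "algebra \<Omega> (\<Union>n. L n)"
    unfolding algebra_iff_Un
  proof (intro conjI ballI)
    show "(\<Union>n. L n) \<subseteq> Pow \<Omega>" using sub Pow by blast
    show "{} \<in> (\<Union>n. L n)" using L0 by blast
    fix a assume "a \<in> (\<Union>n. L n)"
    then obtain n where n: "a \<in> L n" by blast
    hence "\<Omega> - a \<in> L (Suc n)" by (auto simp: LS)
    thus "\<Omega> - a \<in> (\<Union>n. L n)" by blast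
    fix b assume "b \<in> (\<Union>n. L n)"
    then obtain m where m: "b \<in> L m" by blast
    have "a \<in> L (max n m)" "b \<in> L (max n m)" using mono[of n "max n m"] mono[of m "max n m"] n m by auto
    hence "a \<union> b \<in> L (Suc (max n m))" by (force simp: LS)
    thus "a \<union> b \<in> (\<Union>n. L n)" by blast
  qed
  moreover have "C \<subseteq> (\<Union>n. L n)" using L0 by blast
  ultimately show thesis using that[of "\<Union>n. L n"] cnt sub by blast
qed

context prob_space
begin

text \<open>The probability of the symmetric difference is a pseudometric on events; density of a
  family of events is meant with respect to it.\<close>

lemma prob_sym_diff_triangle:
  assumes [measurable]: "A \<in> events" "B \<in> events" "C \<in> events"
  shows "prob (sym_diff A C) \<le> prob (sym_diff A B) + prob (sym_diff B C)"
proof -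
  have "prob (sym_diff A C) \<le> prob (sym_diff A B \<union> sym_diff B C)"
    by (intro finite_measure_mono) auto
  also have "\<dots> \<le> prob (sym_diff A B) + prob (sym_diff B C)"
    by (intro measure_Un_le) auto
  finally show ?thesis .
qed

text \<open>Induction over the generated sigma-algebra. Complements preserve symmetric differences;
  a countable union is first cut to a finite one by continuity from below, and then its finitely
  many members are approximated.\<close>

lemma algebra_approximates_sigma_sets:
  assumes alg: "algebra (space M) \<A>" and ev: "\<A> \<subseteq> events"
    and B: "B \<in> sigma_sets (space M) \<A>" and "0 < (\<epsilon>::real)"
  shows "\<exists>A\<in>\<A>. prob (sym_diff B A) < \<epsilon>"
  using B \<open>0 < \<epsilon>\<close>
proof (induction arbitrary: \<epsilon>)
  case (Basic a)
  thus ?case by (intro bexI[of _ a]) auto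
next
  case Empty
  interpret algebra "space M" \<A> by fact
  show ?case using Empty by (intro bexI[of _ "{}"]) auto
next
  case (Compl a)
  interpret \<A>: algebra "space M" \<A> by fact
  obtain b where b: "b \<in> \<A>" "prob (sym_diff a b) < \<epsilon>" using Compl by blast
  have "a \<subseteq> space M" "b \<subseteq> space M"
    using sigma_sets_into_sp[OF \<A>.space_closed Compl.hyps] b \<A>.space_closed by auto
  hence "sym_diff (space M - a) (space M - b) = sym_diff a b" by blast
  thus ?case using b \<A>.compl_sets by (intro bexI[of _ "space M - b"]) auto
next
  case (Union a)
  interpret \<A>: algebra "space M" \<A> by fact
  have aev [measurable]: "a i \<in> events" for i
    using Union.hyps sets.sigma_sets_subset[OF ev] by blast
  have "(\<lambda>n. prob (\<Union>i<n. a i)) \<longlonglongrightarrow> prob (\<Union>n. \<Union>i<n. a i)"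
  proof (rule finite_Lim_measure_incseq)
    show "incseq (\<lambda>n. \<Union>i<n. a i)" unfolding incseq_def by (intro allI impI UN_mono) auto
  qed auto
  moreover have "(\<Union>n. \<Union>i<n. a i) = (\<Union>i. a i)" by blast
  ultimately have "eventually (\<lambda>n. prob (\<Union>i. a i) - \<epsilon> / 2 < prob (\<Union>i<n. a i)) sequentially"
    using Union.prems by (intro order_tendstoD) auto
  then obtain n where n: "prob (\<Union>i. a i) - \<epsilon> / 2 < prob (\<Union>i<n. a i)"
    by (auto simp: eventually_sequentially)
  \<comment> \<open>The \<open>n\<close> tolerances add up to at most \<open>\<epsilon> / 2\<close>;
    the \<open>+ 1\<close> covers \<open>n = 0\<close>.\<close>
  have "\<forall>i. \<exists>b\<in>\<A>. prob (sym_diff (a i) b) < \<epsilon> / (2 * (real n + 1))"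
    using Union.IH Union.prems by simp
  then obtain b where b: "b i \<in> \<A>" "prob (sym_diff (a i) (b i)) < \<epsilon> / (2 * (real n + 1))" for i
    by metis
  have bev [measurable]: "b i \<in> events" for i using b ev by blast
  have "prob (sym_diff (\<Union>i. a i) (\<Union>i<n. b i))
      \<le> prob (sym_diff (\<Union>i. a i) (\<Union>i<n. a i)) + prob (sym_diff (\<Union>i<n. a i) (\<Union>i<n. b i))"
    by (intro prob_sym_diff_triangle) auto
  also have "sym_diff (\<Union>i. a i) (\<Union>i<n. a i) = (\<Union>i. a i) - (\<Union>i<n. a i)" by blast
  also have "prob \<dots> = prob (\<Union>i. a i) - prob (\<Union>i<n. a i)"
    by (intro finite_measure_Diff) auto
  also have "prob (sym_diff (\<Union>i<n. a i) (\<Union>i<n. b i)) \<le> prob (\<Union>i<n. sym_diff (a i) (b i))"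
    by (intro finite_measure_mono) auto
  also have "\<dots> \<le> (\<Sum>i<n. prob (sym_diff (a i) (b i)))"
    by (intro finite_measure_subadditive_finite) auto
  also have "\<dots> \<le> (\<Sum>i<n. \<epsilon> / (2 * (real n + 1)))"
    using b by (intro sum_mono less_imp_le)
  also have "\<dots> \<le> \<epsilon> / 2" using Union.prems by (simp add: field_simps)
  finally have "prob (sym_diff (\<Union>i. a i) (\<Union>i<n. b i)) < \<epsilon>" using n by simp
  thus ?case using b by (intro bexI[of _ "\<Union>i<n. b i"]) auto
qed

text \<open>Neither \<open>S \<subseteq> \<A>\<close> nor \<open>\<A> \<subseteq> S\<close>: the generators of \<open>\<F>\<^sub>\<infinity>\<close> modulo null sets need not belong to
  any \<open>\<F>\<^sub>n\<close>.\<close>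

lemma countable_dense_subset_of_dense:
  assumes ev: "\<G> \<subseteq> events" "\<A> \<subseteq> events" and S: "countable S" "S \<subseteq> events"
    and S_dense: "\<And>A \<epsilon>. A \<in> \<G> \<Longrightarrow> (0::real) < \<epsilon> \<Longrightarrow> \<exists>B\<in>S. prob (sym_diff A B) < \<epsilon>"
    and A_dense: "\<And>A \<epsilon>. A \<in> \<G> \<Longrightarrow> (0::real) < \<epsilon> \<Longrightarrow> \<exists>B\<in>\<A>. prob (sym_diff A B) < \<epsilon>"
  obtains D where "countable D" "D \<subseteq> \<A>"
    "\<And>A \<epsilon>. A \<in> \<G> \<Longrightarrow> (0::real) < \<epsilon> \<Longrightarrow> \<exists>B\<in>D. prob (sym_diff A B) < \<epsilon>"
proof -
  \<comment> \<open>For every pair \<open>(s, k)\<close> one member of \<open>\<A>\<close> within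
    \<open>1 / (k + 1)\<close> of \<open>s\<close> is selected, provided there is one; countably
    many pairs give a countable \<open>D\<close>.\<close>
  define P where "P s k a \<longleftrightarrow> a \<in> \<A> \<and> prob (sym_diff s a) < 1 / real (Suc k)" for s k a
  define I where "I = {(s, k). s \<in> S \<and> (\<exists>a. P s k a)}"
  define D where "D = (\<lambda>(s, k). SOME a. P s k a) ` I"
  have P: "P s k (SOME a. P s k a)" if "(s, k) \<in> I" for s k
    using that by (auto simp: I_def intro: someI)
  have "countable (S \<times> (UNIV :: nat set))" using S by simp
  hence "countable I" by (rule countable_subset[rotated]) (auto simp: I_def)
  hence "countable D" by (simp add: D_def)
  moreover have "D \<subseteq> \<A>" using P by (auto simp: D_def P_def)
  moreover have "\<exists>B\<in>D. prob (sym_diff A B) < \<epsilon>" if A: "A \<in> \<G>" and \<epsilon>: "0 < \<epsilon>" for A and \<epsilon> :: real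
  proof -
    obtain k where k: "1 / real (Suc k) < \<epsilon> / 2" using nat_approx_posE[of "\<epsilon> / 2"] \<epsilon> by auto
    define \<delta> where "\<delta> = 1 / (2 * real (Suc k))"
    have \<delta>: "0 < \<delta>" "\<delta> + \<delta> = 1 / real (Suc k)" by (auto simp: \<delta>_def field_simps)
    obtain s where s: "s \<in> S" "prob (sym_diff A s) < \<delta>" using S_dense A \<delta> by blast
    obtain a where a: "a \<in> \<A>" "prob (sym_diff A a) < \<delta>" using A_dense A \<delta> by blast
    have "prob (sym_diff s a) \<le> prob (sym_diff s A) + prob (sym_diff A a)"
      using s a A ev S by (intro prob_sym_diff_triangle) auto
    also have "sym_diff s A = sym_diff A s" by blast
    finally have "P s k a" using s a \<delta> by (simp add: P_def)
    hence I: "(s, k) \<in> I" using s by (auto simp: I_def)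
    define b where "b = (SOME a. P s k a)"
    have b: "P s k b" using P[OF I] by (simp add: b_def)
    have "prob (sym_diff A b) \<le> prob (sym_diff A s) + prob (sym_diff s b)"
      using s b A ev S by (intro prob_sym_diff_triangle) (auto simp: P_def)
    also have "\<dots> < \<epsilon>" using s b k \<delta> by (simp add: P_def)
    finally show ?thesis using I by (auto simp: D_def b_def intro!: bexI[of _ "(s, k)"])
  qed
  ultimately show thesis using that by blast
qed

end

section \<open>Step functions and approximation in probability\<close>

text \<open>Lists with possibly overlapping sets make addition concatenation, and countability of
  the resulting set of functions follows from that of lists over a countable set.\<close>

definition step_function :: "('a set \<times> 'e) list \<Rightarrow> 'a \<Rightarrow> 'e::real_normed_vector" where
  "step_function l \<omega> = (\<Sum>(A, e) \<leftarrow> l. indicator A \<omega> *\<^sub>R e)"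

lemma step_function_Nil [simp]: "step_function [] = (\<lambda>_. 0)"
  and step_function_Cons [simp]:
    "step_function ((A, e) # l) = (\<lambda>\<omega>. indicator A \<omega> *\<^sub>R e + step_function l \<omega>)"
  and step_function_append:
    "step_function (l @ l') = (\<lambda>\<omega>. step_function l \<omega> + step_function l' \<omega>)"
  by (simp_all add: step_function_def fun_eq_iff)

lemma step_function_measurable:
  assumes "\<And>A e. (A, e) \<in> set l \<Longrightarrow> A \<in> sets N"
  shows "(step_function l :: 'a \<Rightarrow> 'e::{real_normed_vector, second_countable_topology}) \<in> borel_measurable N"
  using assms
proof (induction l)
  case (Cons p l)
  obtain A e where p: "p = (A, e)" by (cases p)
  have [measurable]: "A \<in> sets N" "step_function l \<in> borel_measurable N" using Cons p by auto
  show ?case unfolding p step_function_Cons by measurable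
qed simp

context prob_space
begin

text \<open>For measurable functions this says that \<open>f\<close> lies in the closure of
  \<open>U\<close> for convergence in probability; a single \<open>\<epsilon>\<close> bounds both
  the distance and the exceptional probability.\<close>

definition prob_approximable :: "('a \<Rightarrow> 'e::metric_space) set \<Rightarrow> ('a \<Rightarrow> 'e) \<Rightarrow> bool" where
  "prob_approximable U f \<longleftrightarrow>
     (\<forall>\<epsilon>>0. \<exists>g\<in>U. prob {\<omega>\<in>space M. \<epsilon> < dist (g \<omega>) (f \<omega>)} < \<epsilon>)"

lemma prob_approximable_cong:
  assumes "\<And>\<omega>. \<omega> \<in> space M \<Longrightarrow> f \<omega> = g \<omega>"
  shows "prob_approximable U f = prob_approximable U g"
proof -
  have "{\<omega>\<in>space M. \<epsilon> < dist (h \<omega>) (f \<omega>)} = {\<omega>\<in>space M. \<epsilon> < dist (h \<omega>) (g \<omega>)}" for h \<epsilon>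
    using assms by auto
  thus ?thesis by (simp add: prob_approximable_def)
qed

lemma prob_approximable_add:
  fixes f g :: "'a \<Rightarrow> 'e::{real_normed_vector, second_countable_topology}"
  assumes f: "prob_approximable U f" "f \<in> borel_measurable M"
    and g: "prob_approximable U g" "g \<in> borel_measurable M"
    and U: "U \<subseteq> borel_measurable M" "\<And>u v. u \<in> U \<Longrightarrow> v \<in> U \<Longrightarrow> (\<lambda>\<omega>. u \<omega> + v \<omega>) \<in> U"
  shows "prob_approximable U (\<lambda>\<omega>. f \<omega> + g \<omega>)"
  unfolding prob_approximable_def
proof (intro allI impI)
  fix \<epsilon> :: real assume "0 < \<epsilon>"
  hence "0 < \<epsilon> / 2" by simp
  then obtain u v where u: "u \<in> U" "prob {\<omega>\<in>space M. \<epsilon> / 2 < dist (u \<omega>) (f \<omega>)} < \<epsilon> / 2"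
    and v: "v \<in> U" "prob {\<omega>\<in>space M. \<epsilon> / 2 < dist (v \<omega>) (g \<omega>)} < \<epsilon> / 2"
    using f g unfolding prob_approximable_def by blast
  have [measurable]: "u \<in> borel_measurable M" "v \<in> borel_measurable M"
    "f \<in> borel_measurable M" "g \<in> borel_measurable M" using u v f g U by auto
  have "\<epsilon> / 2 < dist (u \<omega>) (f \<omega>) \<or> \<epsilon> / 2 < dist (v \<omega>) (g \<omega>)"
    if "\<epsilon> < dist (u \<omega> + v \<omega>) (f \<omega> + g \<omega>)" for \<omega>
    using dist_triangle_add[of "u \<omega>" "v \<omega>" "f \<omega>" "g \<omega>"] that by linarith
  hence "prob {\<omega>\<in>space M. \<epsilon> < dist (u \<omega> + v \<omega>) (f \<omega> + g \<omega>)} \<le>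
    prob ({\<omega>\<in>space M. \<epsilon> / 2 < dist (u \<omega>) (f \<omega>)} \<union> {\<omega>\<in>space M. \<epsilon> / 2 < dist (v \<omega>) (g \<omega>)})"
    by (intro finite_measure_mono) auto
  also have "\<dots> \<le> prob {\<omega>\<in>space M. \<epsilon> / 2 < dist (u \<omega>) (f \<omega>)} + prob {\<omega>\<in>space M. \<epsilon> / 2 < dist (v \<omega>) (g \<omega>)}"
    by (intro measure_Un_le) auto
  finally show "\<exists>h\<in>U. prob {\<omega>\<in>space M. \<epsilon> < dist (h \<omega>) (f \<omega> + g \<omega>)} < \<epsilon>"
    using u v U by (intro bexI[of _ "\<lambda>\<omega>. u \<omega> + v \<omega>"]) auto
qed

text \<open>The events that some term from \<open>n\<close> on is far from the limit decrease to the
  empty set. Hence some \<open>s n\<close> is close to \<open>f\<close> in probability, and an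
  approximation of \<open>s n\<close> serves for \<open>f\<close>.\<close>

lemma prob_approximable_LIMSEQ:
  fixes f :: "'a \<Rightarrow> 'e::{metric_space, second_countable_topology}"
  assumes s: "\<And>i. prob_approximable U (s i)" "\<And>i. s i \<in> borel_measurable M"
    and f: "f \<in> borel_measurable M" and lim: "\<And>\<omega>. \<omega> \<in> space M \<Longrightarrow> (\<lambda>i. s i \<omega>) \<longlonglongrightarrow> f \<omega>"
    and U: "U \<subseteq> borel_measurable M"
  shows "prob_approximable U f"
  unfolding prob_approximable_def
proof (intro allI impI)
  fix \<epsilon> :: real assume "0 < \<epsilon>"
  hence \<epsilon>: "0 < \<epsilon> / 2" by simp
  note [measurable] = s(2) f
  let ?B = "\<lambda>n. {\<omega>\<in>space M. \<exists>i\<ge>n. \<epsilon> / 2 < dist (s i \<omega>) (f \<omega>)}"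
  have "(\<lambda>n. prob (?B n)) \<longlonglongrightarrow> prob (\<Inter>n. ?B n)"
    by (rule finite_Lim_measure_decseq) (auto simp: decseq_def intro: order_trans)
  moreover have "(\<Inter>n. ?B n) = {}"
  proof -
    have "\<exists>n. \<omega> \<notin> ?B n" if "\<omega> \<in> space M" for \<omega>
      using metric_LIMSEQ_D[OF lim[OF that] \<epsilon>] by (auto simp: not_less) (meson less_imp_le)
    thus ?thesis by (intro equals0I) blast
  qed
  ultimately have "(\<lambda>n. prob (?B n)) \<longlonglongrightarrow> 0" by simp
  hence "eventually (\<lambda>n. prob (?B n) < \<epsilon> / 2) sequentially" using \<epsilon> by (rule order_tendstoD)
  then obtain n where n: "prob (?B n) < \<epsilon> / 2" by (auto simp: eventually_sequentially)
  obtain u where u: "u \<in> U" "prob {\<omega>\<in>space M. \<epsilon> / 2 < dist (u \<omega>) (s n \<omega>)} < \<epsilon> / 2"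
    using s(1)[of n] \<epsilon> unfolding prob_approximable_def by blast
  have [measurable]: "u \<in> borel_measurable M" using u U by auto
  have "\<epsilon> / 2 < dist (u \<omega>) (s n \<omega>) \<or> \<epsilon> / 2 < dist (s n \<omega>) (f \<omega>)"
    if "\<epsilon> < dist (u \<omega>) (f \<omega>)" for \<omega>
    using dist_triangle[of "u \<omega>" "f \<omega>" "s n \<omega>"] that by linarith
  hence "prob {\<omega>\<in>space M. \<epsilon> < dist (u \<omega>) (f \<omega>)} \<le>
    prob ({\<omega>\<in>space M. \<epsilon> / 2 < dist (u \<omega>) (s n \<omega>)} \<union> ?B n)"
    by (intro finite_measure_mono) auto
  also have "\<dots> \<le> prob {\<omega>\<in>space M. \<epsilon> / 2 < dist (u \<omega>) (s n \<omega>)} + prob (?B n)"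
    by (intro measure_Un_le) auto
  also have "\<dots> < \<epsilon>" using n u by linarith
  finally show "\<exists>g\<in>U. prob {\<omega>\<in>space M. \<epsilon> < dist (g \<omega>) (f \<omega>)} < \<epsilon>" using u by blast
qed

text \<open>The class of approximable functions is extended from scaled indicators to their finite
  sums, hence to simple functions, and then to pointwise limits.\<close>

lemma step_functions_approximate:
  fixes f :: "'a \<Rightarrow> 'e::{real_normed_vector, second_countable_topology}"
  assumes sub: "subalgebra M G" and D: "D \<subseteq> events"
    and D_dense: "\<And>A \<epsilon>. A \<in> sets G \<Longrightarrow> (0::real) < \<epsilon> \<Longrightarrow> \<exists>B\<in>D. prob (sym_diff A B) < \<epsilon>"
    and Y: "\<And>X :: 'e set. open X \<Longrightarrow> X \<noteq> {} \<Longrightarrow> \<exists>y\<in>Y. y \<in> X"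
    and f: "f \<in> borel_measurable G"
  shows "prob_approximable (step_function ` lists (D \<times> Y)) f"
proof -
  define U where "U = (step_function ` lists (D \<times> Y) :: ('a \<Rightarrow> 'e) set)"
  have Gev: "A \<in> events" if "A \<in> sets G" for A using that sub by (auto simp: subalgebra_def)
  have GM: "space G = space M" using sub by (simp add: subalgebra_def)
  have U: "U \<subseteq> borel_measurable M"
    unfolding U_def using D by (auto intro!: step_function_measurable)
  have U_add: "(\<lambda>\<omega>. u \<omega> + v \<omega>) \<in> U" if uv: "u \<in> U" "v \<in> U" for u v
  proof -
    obtain k l where "k \<in> lists (D \<times> Y)" "l \<in> lists (D \<times> Y)" "u = step_function k" "v = step_function l"
      using uv unfolding U_def by blast
    thus ?thesis unfolding U_def by (intro image_eqI[of _ _ "k @ l"]) (auto simp: step_function_append)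
  qed
  have zero: "prob_approximable U (\<lambda>_. 0)"
    unfolding prob_approximable_def
  proof (intro allI impI bexI)
    show "(\<lambda>_. 0) \<in> U" unfolding U_def by (intro image_eqI[of _ _ "[]"]) auto
  qed simp
  have ind: "prob_approximable U (\<lambda>\<omega>. indicator A \<omega> *\<^sub>R y)" if A: "A \<in> sets G" for A y
    unfolding prob_approximable_def
  proof (intro allI impI)
    fix \<epsilon> :: real assume \<epsilon>: "0 < \<epsilon>"
    obtain B where B: "B \<in> D" "prob (sym_diff A B) < \<epsilon>" using D_dense A \<epsilon> by blast
    have [measurable]: "A \<in> events" "B \<in> events" using A Gev B D by auto
    obtain e where e: "e \<in> Y" "e \<in> ball y \<epsilon>" using Y[of "ball y \<epsilon>"] \<epsilon> by auto
    \<comment> \<open>Off the symmetric difference the two indicators agree, so the distance is at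
      most that of \<open>e\<close> and \<open>y\<close>, which is below
      \<open>\<epsilon>\<close>.\<close>
    have "\<omega> \<in> sym_diff A B" if "\<epsilon> < dist (indicator B \<omega> *\<^sub>R e) (indicator A \<omega> *\<^sub>R y)" for \<omega>
    proof (rule ccontr)
      assume "\<omega> \<notin> sym_diff A B"
      hence "dist (indicator B \<omega> *\<^sub>R e) (indicator A \<omega> *\<^sub>R y) \<le> dist y e"
        by (cases "\<omega> \<in> A"; cases "\<omega> \<in> B") (auto simp: dist_commute)
      thus False using that e by simp
    qed
    hence "{\<omega>\<in>space M. \<epsilon> < dist (indicator B \<omega> *\<^sub>R e) (indicator A \<omega> *\<^sub>R y)} \<subseteq> sym_diff A B"
      by blast
    hence "prob {\<omega>\<in>space M. \<epsilon> < dist (indicator B \<omega> *\<^sub>R e) (indicator A \<omega> *\<^sub>R y)} \<le> prob (sym_diff A B)"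
      by (rule finite_measure_mono) measurable
    hence "prob {\<omega>\<in>space M. \<epsilon> < dist (step_function [(B, e)] \<omega>) (indicator A \<omega> *\<^sub>R y)} < \<epsilon>"
      using B by simp
    moreover have "step_function [(B, e)] \<in> U"
      using B e unfolding U_def by (intro imageI) auto
    ultimately show "\<exists>g\<in>U. prob {\<omega>\<in>space M. \<epsilon> < dist (g \<omega>) (indicator A \<omega> *\<^sub>R y)} < \<epsilon>" by (rule bexI)
  qed
  have simple: "prob_approximable U s" if s: "simple_function G s" for s :: "'a \<Rightarrow> 'e"
  proof -
    let ?A = "\<lambda>y. s -` {y} \<inter> space M"
    have fin: "finite (s ` space M)" and A: "?A y \<in> sets G" for y
      using simple_functionD[OF s] GM by auto
    have "prob_approximable U (\<lambda>\<omega>. \<Sum>y\<in>T. indicator (?A y) \<omega> *\<^sub>R y)" if "finite T" for T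
      using that
    proof induction
      case (insert y T)
      have [measurable]: "?A y \<in> events" for y using A Gev by blast
      have "prob_approximable U (\<lambda>\<omega>. indicator (?A y) \<omega> *\<^sub>R y + (\<Sum>y\<in>T. indicator (?A y) \<omega> *\<^sub>R y))"
        by (intro prob_approximable_add ind A insert U U_add) measurable
      thus ?case unfolding sum.insert[OF insert.hyps] .
    qed (simp add: zero)
    from this[OF fin] show ?thesis
    proof (subst prob_approximable_cong)
      fix \<omega> assume \<omega>: "\<omega> \<in> space M"
      have "(\<Sum>y\<in>s ` space M. indicator (?A y) \<omega> *\<^sub>R y) = (\<Sum>y\<in>s ` space M. if y = s \<omega> then y else 0)"
        using \<omega> by (intro sum.cong) (auto simp: indicator_def)
      also have "\<dots> = s \<omega>" using fin \<omega> by simp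
      finally show "s \<omega> = (\<Sum>y\<in>s ` space M. indicator (?A y) \<omega> *\<^sub>R y)" by simp
    qed
  qed
  obtain s where s: "\<And>i. simple_function G (s i)" "\<And>\<omega>. \<omega> \<in> space M \<Longrightarrow> (\<lambda>i. s i \<omega>) \<longlonglongrightarrow> f \<omega>"
    using f GM unfolding strongly_measurable_iff_borel[symmetric] strongly_measurable_def by metis
  show ?thesis unfolding U_def[symmetric]
  proof (rule prob_approximable_LIMSEQ[OF simple[OF s(1)] _ _ s(2) U])
    show "s i \<in> borel_measurable M" for i
      using measurable_from_subalg[OF sub borel_measurable_simple_function[OF s(1)]] .
    show "f \<in> borel_measurable M" using measurable_from_subalg[OF sub f] .
  qed
qed

end

section \<open>Countable density in the functions measurable at infinity\<close>

context filtered_brownian_motion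
begin

lemma algebra_UN_F: "algebra (space M) (\<Union>n::nat. sets (F (real n)))"
  unfolding algebra_iff_Un
proof (intro conjI ballI)
  show "(\<Union>n::nat. sets (F (real n))) \<subseteq> Pow (space M)"
    using sets.space_closed space_F by (metis UN_least of_nat_0_le_iff)
  show "{} \<in> (\<Union>n::nat. sets (F (real n)))" by auto
  fix a assume "a \<in> (\<Union>n::nat. sets (F (real n)))"
  then obtain n where n: "a \<in> sets (F (real n))" by blast
  have "space M - a \<in> sets (F (real n))" using sets.compl_sets[OF n] by simp
  thus "space M - a \<in> (\<Union>n::nat. sets (F (real n)))" by blast
  fix b assume "b \<in> (\<Union>n::nat. sets (F (real n)))"
  then obtain m where m: "b \<in> sets (F (real m))" by blast
  have "a \<in> sets (F (real (max n m)))" "b \<in> sets (F (real (max n m)))"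
    using subalgebra_F_mono[of "real n" "real (max n m)"] subalgebra_F_mono[of "real m" "real (max n m)"] n m
    by (auto simp: subalgebra_def)
  hence "a \<union> b \<in> sets (F (real (max n m)))" by auto
  thus "a \<union> b \<in> (\<Union>n::nat. sets (F (real n)))" by blast
qed

lemma UN_F_subset: "(\<Union>t\<in>{0..}. sets (F t)) \<subseteq> events"
  using subalgebra_F by (auto simp: subalgebra_def)

text \<open>Integer times suffice as the filtration increases. The generator obtained is an algebra,
  as the approximation of events requires.\<close>

lemma sets_F_infinity: "sets (F_infinity M F) = sigma_sets (space M) (\<Union>n::nat. sets (F (real n)))"
proof -
  have "(\<Union>t\<in>{0..}. sets (F t)) \<subseteq> Pow (space M)" using UN_F_subset sets.space_closed by blast
  hence "sets (F_infinity M F) = sigma_sets (space M) (\<Union>t\<in>{0..}. sets (F t))"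
    by (simp add: F_infinity_def)
  also have "(\<Union>t\<in>{0..}. sets (F t)) = (\<Union>n::nat. sets (F (real n)))"
  proof (intro equalityI subsetI)
    fix A assume "A \<in> (\<Union>t\<in>{0..}. sets (F t))"
    then obtain t where t: "0 \<le> t" "A \<in> sets (F t)" by auto
    obtain n :: nat where "t \<le> real n" using real_arch_simple by blast
    hence "A \<in> sets (F (real n))" using t subalgebra_F_mono[of t "real n"] by (auto simp: subalgebra_def)
    thus "A \<in> (\<Union>n::nat. sets (F (real n)))" by blast
  qed auto
  finally show ?thesis .
qed

lemma subalgebra_F_infinity: "subalgebra M (F_infinity M F)"
proof -
  have "(\<Union>n::nat. sets (F (real n))) \<subseteq> events" using UN_F_subset by fastforce
  hence "sets (F_infinity M F) \<subseteq> events"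
    unfolding sets_F_infinity by (rule sets.sigma_sets_subset)
  thus ?thesis by (simp add: subalgebra_def F_infinity_def space_measure_of_conv)
qed

lemma exists_dense_sequence:
  assumes "countably_generated_mod_null M (F_infinity M F)"
  obtains u :: "nat \<Rightarrow> 'a \<Rightarrow> 'e::{real_normed_vector, second_countable_topology}" where
    "\<And>j. \<exists>m::nat. u j \<in> borel_measurable (F (real m))"
    "\<And>\<xi>. \<xi> \<in> borel_measurable (F_infinity M F) \<Longrightarrow> prob_approximable (range u) \<xi>"
proof -
  let ?A = "\<Union>n::nat. sets (F (real n))"
  have A: "?A \<subseteq> events" using UN_F_subset by fastforce
  obtain C where C: "countable C" "C \<subseteq> events"
    "\<And>A. A \<in> sets (F_infinity M F) \<Longrightarrow> \<exists>B\<in>sigma_sets (space M) C. sym_diff A B \<in> null_sets M"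
    using assms unfolding countably_generated_mod_null_def by metis
  have "C \<subseteq> Pow (space M)" using C(2) sets.space_closed by (rule subset_trans)
  then obtain S where S: "countable S" "C \<subseteq> S" "algebra (space M) S" "S \<subseteq> sigma_sets (space M) C"
    by (rule countable_algebra_containing[OF C(1)])
  have Cev: "sigma_sets (space M) C \<subseteq> events" by (rule sets.sigma_sets_subset[OF C(2)])
  hence Sev: "S \<subseteq> events" using S by blast
  have F_ev: "sets (F_infinity M F) \<subseteq> events" using subalgebra_F_infinity by (simp add: subalgebra_def)
  have S_dense: "\<exists>B\<in>S. prob (sym_diff A B) < \<epsilon>"
    if A: "A \<in> sets (F_infinity M F)" and \<epsilon>: "0 < \<epsilon>" for A and \<epsilon> :: real
  proof -
    obtain B where B: "B \<in> sigma_sets (space M) C" "sym_diff A B \<in> null_sets M" using C A by blast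
    have "B \<in> sigma_sets (space M) S" using B S sigma_sets_mono'[of C S] by blast
    then obtain s where s: "s \<in> S" "prob (sym_diff B s) < \<epsilon>"
      using algebra_approximates_sigma_sets[OF S(3) Sev _ \<epsilon>] by blast
    have "prob (sym_diff A s) \<le> prob (sym_diff A B) + prob (sym_diff B s)"
      using A F_ev B Cev s Sev by (intro prob_sym_diff_triangle) auto
    also have "prob (sym_diff A B) = 0" using B(2) by (simp add: measure_def null_setsD1)
    finally show ?thesis using s by (intro bexI[of _ s]) linarith+
  qed
  \<comment> \<open>\<open>S\<close> supplies countability and the union of the \<open>F n\<close>
    supplies measurability at a finite time; \<open>D\<close> combines both.\<close>
  obtain D where D: "countable D" "D \<subseteq> ?A"
    "\<And>A \<epsilon>. A \<in> sets (F_infinity M F) \<Longrightarrow> (0::real) < \<epsilon> \<Longrightarrow> \<exists>B\<in>D. prob (sym_diff A B) < \<epsilon>"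
    using countable_dense_subset_of_dense[OF F_ev A S(1) Sev S_dense
        algebra_approximates_sigma_sets[OF algebra_UN_F A, folded sets_F_infinity]] by blast
  obtain Y :: "'e set" where Y: "countable Y" "\<And>X. open X \<Longrightarrow> X \<noteq> {} \<Longrightarrow> \<exists>y\<in>Y. y \<in> X"
    using countable_dense_exists by blast
  define U where "U = (step_function ` lists (D \<times> Y) :: ('a \<Rightarrow> 'e) set)"
  have "countable U" unfolding U_def using D Y by (intro countable_image countable_lists) auto
  moreover have "U \<noteq> {}" unfolding U_def by auto
  ultimately have u: "range (from_nat_into U) = U" by (simp add: range_from_nat_into)
  \<comment> \<open>Only finitely many sets occur in a list, so the largest of their times serves
    for all of them.\<close>
  have meas: "\<exists>m::nat. step_function l \<in> borel_measurable (F (real m))" if "l \<in> lists (D \<times> Y)" for l :: "('a set \<times> 'e) list"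
    using that
  proof (induction l)
    case (Cons p l)
    obtain A e where p: "p = (A, e)" by (cases p)
    obtain m n :: nat where m: "A \<in> sets (F (real m))" and n: "step_function l \<in> borel_measurable (F (real n))"
      using Cons D p by auto
    have [measurable]: "A \<in> sets (F (real (max m n)))" "step_function l \<in> borel_measurable (F (real (max m n)))"
      using subalgebra_F_mono[of "real m" "real (max m n)"] m measurable_F_mono[OF n, of "real (max m n)"]
      by (auto simp: subalgebra_def)
    show ?case unfolding p step_function_Cons by (intro exI[of _ "max m n"]) measurable
  qed simp
  have "\<exists>m::nat. from_nat_into U j \<in> borel_measurable (F (real m))" for j
  proof -
    have "from_nat_into U j \<in> U" using u by blast
    then obtain l where "l \<in> lists (D \<times> Y)" "from_nat_into U j = step_function l"
      unfolding U_def by blast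
    thus ?thesis using meas by simp
  qed
  moreover have "prob_approximable (range (from_nat_into U)) \<xi>"
    if "\<xi> \<in> borel_measurable (F_infinity M F)" for \<xi>
    unfolding u unfolding U_def using D(2) A
    by (intro step_functions_approximate[OF subalgebra_F_infinity _ D(3) Y(2) that]) auto
  ultimately show thesis using that by blast
qed

text \<open>Density of every tail, not just of the whole range, is what later permits strictly
  increasing indices.\<close>

lemma exists_target_sequence:
  assumes "countably_generated_mod_null M (F_infinity M F)"
  obtains \<tau> :: "nat \<Rightarrow> 'a \<Rightarrow> 'e::{real_normed_vector, second_countable_topology}" where
    "\<And>n. \<tau> n \<in> borel_measurable (F (real n))"
    "\<And>\<xi> m. \<xi> \<in> borel_measurable (F_infinity M F) \<Longrightarrow> prob_approximable (\<tau> ` {m..}) \<xi>"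
proof -
  obtain u :: "nat \<Rightarrow> 'a \<Rightarrow> 'e" where
    u: "\<And>j. \<exists>m::nat. u j \<in> borel_measurable (F (real m))"
      "\<And>\<xi>. \<xi> \<in> borel_measurable (F_infinity M F) \<Longrightarrow> prob_approximable (range u) \<xi>"
    using exists_dense_sequence[OF assms] by blast
  \<comment> \<open>Each \<open>u j\<close> recurs infinitely often, and from some time on it is measurable when its turn comes.\<close>
  define v where "v n = u (fst (prod_decode n))" for n
  define \<tau> where "\<tau> n = (if v n \<in> borel_measurable (F (real n)) then v n else (\<lambda>_. 0))" for n
  have "\<tau> n \<in> borel_measurable (F (real n))" for n by (simp add: \<tau>_def)
  moreover have "prob_approximable (\<tau> ` {m..}) \<xi>" if "\<xi> \<in> borel_measurable (F_infinity M F)" for \<xi> m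
  proof -
    have "u j \<in> \<tau> ` {m..}" for j
    proof -
      obtain k where k: "u j \<in> borel_measurable (F (real k))" using u by blast
      \<comment> \<open>\<open>prod_encode\<close> dominates its second component, so
        \<open>n\<close> is late enough both for measurability (\<open>k\<close>) and for the tail
        (\<open>m\<close>).\<close>
      define n where "n = prod_encode (j, max k m)"
      have n: "max k m \<le> n" unfolding n_def by (rule le_prod_encode_2)
      have "v n = u j" by (simp add: v_def n_def)
      moreover have "u j \<in> borel_measurable (F (real n))" using measurable_F_mono[OF k] n by simp
      ultimately have "\<tau> n = u j" by (simp add: \<tau>_def)
      thus ?thesis using n by (intro image_eqI[of _ _ n]) auto
    qed
    hence "range u \<subseteq> \<tau> ` {m..}" by blast
    thus ?thesis using u(2)[OF that] unfolding prob_approximable_def by (meson subsetD)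
  qed
  ultimately show thesis using that by blast
qed

end

section \<open>Concatenation of step processes\<close>

lemma step_integral_Nil [simp]: "step_integral W [] t \<omega> = 0"
  and step_integral_Cons [simp]: "step_integral W ((c, d, \<eta>) # ps) t \<omega> =
    (W (min d t) \<omega> - W (min c t) \<omega>) *\<^sub>R \<eta> \<omega> + step_integral W ps t \<omega>"
  and step_integral_append: "step_integral W (ps @ qs) t \<omega> = step_integral W ps t \<omega> + step_integral W qs t \<omega>"
  by (simp_all add: step_integral_def)

lemma step_process_Nil [simp]: "step_process [] t \<omega> = 0"
  and step_process_Cons [simp]: "step_process ((c, d, \<eta>) # ps) t \<omega> =
    indicator {c<..d} t *\<^sub>R \<eta> \<omega> + step_process ps t \<omega>"
  and step_process_append: "step_process (ps @ qs) t \<omega> = step_process ps t \<omega> + step_process qs t \<omega>"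
  by (simp_all add: step_process_def)

lemma adapted_step_Nil [simp]: "adapted_step F T []"
  and adapted_step_Cons [simp]: "adapted_step F T ((c, d, \<eta>) # ps) \<longleftrightarrow>
    0 \<le> c \<and> c < d \<and> d \<le> T \<and> strongly_measurable (F c) \<eta> \<and> adapted_step F T ps"
  and adapted_step_append: "adapted_step F T (ps @ qs) \<longleftrightarrow> adapted_step F T ps \<and> adapted_step F T qs"
  by (simp_all add: adapted_step_def ball_Un)

lemma adapted_step_mono: "adapted_step F S ps \<Longrightarrow> S \<le> T \<Longrightarrow> adapted_step F T ps"
  by (fastforce simp: adapted_step_def)

lemma step_integral_eq_at_end:
  "adapted_step F T ps \<Longrightarrow> T \<le> t \<Longrightarrow> step_integral W ps t \<omega> = step_integral W ps T \<omega>"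
  by (induction ps) (auto simp: min_absorb1)

definition starts_after :: "real \<Rightarrow> (real \<times> real \<times> 'b) list \<Rightarrow> bool" where
  "starts_after T ps \<longleftrightarrow> (\<forall>(c, d, \<eta>)\<in>set ps. T \<le> c)"

lemma starts_after_mono: "starts_after T ps \<Longrightarrow> S \<le> T \<Longrightarrow> starts_after S ps"
  by (fastforce simp: starts_after_def)

text \<open>For \<open>t \<le> s \<le> c < d\<close> both \<open>min d t\<close> and
  \<open>min c t\<close> equal \<open>t\<close>, and the left-open interval excludes
  \<open>t\<close>, even for \<open>t = c\<close>.\<close>

lemma step_before_start:
  assumes "starts_after s ps" "adapted_step F T ps" "t \<le> s"
  shows "step_integral W ps t \<omega> = 0" and "step_process ps t \<omega> = 0"
  using assms by (induction ps) (auto simp: starts_after_def min_absorb2)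

text \<open>The filter \<open>c < T\<close> keeps every shortened interval nondegenerate, as
  \<open>adapted_step\<close> demands.\<close>

definition truncate_steps :: "real \<Rightarrow> (real \<times> real \<times> 'b) list \<Rightarrow> (real \<times> real \<times> 'b) list" where
  "truncate_steps T ps = map (\<lambda>(c, d, \<eta>). (c, min d T, \<eta>)) (filter (\<lambda>(c, d, \<eta>). c < T) ps)"

lemma adapted_truncate_steps: "adapted_step F S ps \<Longrightarrow> adapted_step F T (truncate_steps T ps)"
  by (fastforce simp: adapted_step_def truncate_steps_def)

lemma truncate_steps:
  assumes "adapted_step F S ps" "t \<le> T"
  shows "step_integral W (truncate_steps T ps) t \<omega> = step_integral W ps t \<omega>"
    and "step_process (truncate_steps T ps) t \<omega> = step_process ps t \<omega>"
  using assms by (induction ps) (auto simp: truncate_steps_def min_absorb2 min.assoc indicator_def)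

lemma norm_step_process_le: "norm (step_process ps t \<omega>) \<le> (\<Sum>(c, d, \<eta>)\<leftarrow>ps. norm (\<eta> \<omega>))"
proof (induction ps)
  case (Cons p ps)
  obtain c d \<eta> where p: "p = (c, d, \<eta>)" by (cases p)
  have "norm (step_process (p # ps) t \<omega>) \<le> norm (indicator {c<..d} t *\<^sub>R \<eta> \<omega>) + norm (step_process ps t \<omega>)"
    unfolding p step_process_Cons by (rule norm_triangle_ineq)
  also have "norm (indicator {c<..d} t *\<^sub>R \<eta> \<omega>) \<le> norm (\<eta> \<omega>)" by (simp add: indicator_def)
  finally show ?case using Cons by (simp add: p)
qed simp

text \<open>For fixed \<open>\<omega>\<close> the path takes values bounded by a constant
  \<open>K\<close> on a bounded interval.\<close>

lemma sqnorm_L2_step_process_finite: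
  assumes "0 \<le> T"
  shows "sqnorm_L2 T (\<lambda>t. blinfun_apply x (step_process ps t \<omega>)) < \<infinity>"
proof -
  define K where "K = norm x * (\<Sum>(c, d, \<eta>)\<leftarrow>ps. norm (\<eta> \<omega>))"
  have "\<bar>blinfun_apply x (step_process ps t \<omega>)\<bar> \<le> K" for t
  proof -
    have "\<bar>blinfun_apply x (step_process ps t \<omega>)\<bar> \<le> norm x * norm (step_process ps t \<omega>)"
      using norm_blinfun[of x] by simp
    also have "\<dots> \<le> K" unfolding K_def by (intro mult_left_mono norm_step_process_le) auto
    finally show ?thesis .
  qed
  hence K: "(blinfun_apply x (step_process ps t \<omega>))\<^sup>2 \<le> K\<^sup>2" for t
    using abs_le_square_iff order_trans[OF _ abs_ge_self] by blast
  have "sqnorm_L2 T (\<lambda>t. blinfun_apply x (step_process ps t \<omega>)) \<le> (\<integral>\<^sup>+ t\<in>{0..T}. ennreal (K\<^sup>2) \<partial>lborel)"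
    unfolding sqnorm_L2_def using K by (intro nn_integral_mono mult_right_mono ennreal_leI) auto
  also have "\<dots> = ennreal (K\<^sup>2) * ennreal T" using assms by (simp add: nn_integral_cmult_indicator)
  also have "\<dots> < \<infinity>" by (simp add: ennreal_mult_less_top)
  finally show ?thesis .
qed

section \<open>Criteria for convergence in probability\<close>

lemma dist_L2_eq_0:
  assumes "\<And>t. t \<in> {0..T} \<Longrightarrow> f t = g t"
  shows "dist_L2 T f g = 0"
proof -
  have "sqnorm_L2 T (\<lambda>t. f t - g t) = (\<integral>\<^sup>+ (t::real). 0 \<partial>lborel)"
    unfolding sqnorm_L2_def using assms by (intro nn_integral_cong) (auto simp: indicator_def)
  thus ?thesis by (simp add: dist_L2_def)
qed

text \<open>Constant sequences occur because the integrand is itself a step process on each bounded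
  interval; the null set absorbs the discontinuous paths of \<open>W\<close>.\<close>

lemma tendsto_L0_const_null:
  assumes "N \<in> null_sets M" "\<And>\<omega>. \<omega> \<in> space M - N \<Longrightarrow> d (X \<omega>) (Y \<omega>) = 0"
  shows "tendsto_L0 M d (\<lambda>_. X) Y"
proof -
  have "outer_measure_of M {\<omega>\<in>space M. ennreal \<epsilon> < d (X \<omega>) (Y \<omega>)} = 0" for \<epsilon>
  proof -
    have "outer_measure_of M {\<omega>\<in>space M. ennreal \<epsilon> < d (X \<omega>) (Y \<omega>)} \<le> outer_measure_of M N"
      using assms(2) by (intro outer_measure_of_mono) force
    also have "\<dots> = 0" using assms(1) by (simp add: null_setsD1 null_setsD2)
    finally show ?thesis by simp
  qed
  thus ?thesis by (simp add: tendsto_L0_def)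
qed

text \<open>The \<open>k\<close>-th index is chosen beyond the previous one with error
  \<open>1 / (k + 1)\<close>. Once this is below a given \<open>\<epsilon>\<close>, the event for
  \<open>\<epsilon>\<close> is contained in the one for \<open>\<delta> k\<close>.\<close>

lemma (in prob_space) exists_strict_mono_tendsto_L0:
  fixes X :: "nat \<Rightarrow> 'a \<Rightarrow> 'e::{metric_space, second_countable_topology}"
  assumes X [measurable]: "\<And>n. X n \<in> borel_measurable M" and Y [measurable]: "Y \<in> borel_measurable M"
    and approx: "\<And>\<epsilon> m. 0 < \<epsilon> \<Longrightarrow> \<exists>n>m. prob {\<omega>\<in>space M. \<epsilon> < dist (X n \<omega>) (Y \<omega>)} < \<epsilon>"
  shows "\<exists>n. strict_mono n \<and> tendsto_L0 M edist (\<lambda>k. X (n k)) Y"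
proof -
  define \<delta> where "\<delta> k = 1 / real (Suc k)" for k
  have \<delta>: "0 < \<delta> k" for k by (simp add: \<delta>_def)
  have "\<exists>n. \<forall>k. prob {\<omega>\<in>space M. \<delta> k < dist (X (n k) \<omega>) (Y \<omega>)} < \<delta> k \<and> n k < n (Suc k)"
    using approx[OF \<delta>] by (intro dependent_nat_choice) blast+
  then obtain n where n: "prob {\<omega>\<in>space M. \<delta> k < dist (X (n k) \<omega>) (Y \<omega>)} < \<delta> k" "n k < n (Suc k)" for k
    by blast
  have \<delta>_lim: "\<delta> \<longlonglongrightarrow> 0" unfolding \<delta>_def by (rule LIMSEQ_Suc[OF lim_1_over_n])
  have "tendsto_L0 M edist (\<lambda>k. X (n k)) Y"
    unfolding tendsto_L0_def
  proof (intro allI impI)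
    fix \<epsilon> :: real assume \<epsilon>: "0 < \<epsilon>"
    have ev: "{\<omega>\<in>space M. ennreal \<epsilon> < edist (X i \<omega>) (Y \<omega>)} = {\<omega>\<in>space M. \<epsilon> < dist (X i \<omega>) (Y \<omega>)}" for i
      using \<epsilon> by (auto simp: edist_def ennreal_less_iff)
    have "eventually (\<lambda>k. \<delta> k < \<epsilon>) sequentially" using \<delta>_lim \<epsilon> by (rule order_tendstoD)
    hence "eventually (\<lambda>k. outer_measure_of M {\<omega>\<in>space M. ennreal \<epsilon> < edist (X (n k) \<omega>) (Y \<omega>)} \<le> ennreal (\<delta> k)) sequentially"
    proof eventually_elim
      case (elim k)
      have "prob {\<omega>\<in>space M. \<epsilon> < dist (X (n k) \<omega>) (Y \<omega>)} \<le> prob {\<omega>\<in>space M. \<delta> k < dist (X (n k) \<omega>) (Y \<omega>)}"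
        using elim by (intro finite_measure_mono) auto
      also have "\<dots> \<le> \<delta> k" using n(1) less_imp_le by blast
      finally show ?case unfolding ev by (simp add: emeasure_eq_measure ennreal_leI)
    qed
    moreover have "(\<lambda>k. ennreal (\<delta> k)) \<longlonglongrightarrow> 0" using tendsto_ennrealI[OF \<delta>_lim] by simp
    ultimately show "(\<lambda>k. outer_measure_of M {\<omega>\<in>space M. ennreal \<epsilon> < edist (X (n k) \<omega>) (Y \<omega>)}) \<longlonglongrightarrow> 0"
      by (rule tendsto_sandwich[OF always_eventually _ tendsto_const, rotated]) simp
  qed
  moreover have "strict_mono n" using n(2) by (simp add: strict_mono_Suc_iff)
  ultimately show ?thesis by blast
qed

section \<open>Measurability and continuity of step processes, and the integral of a growing
  list\<close>

context filtered_brownian_motion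
begin

text \<open>All starting times are at most \<open>T\<close>, so every \<open>\<eta>\<close> is
  measurable at time \<open>max T t\<close>. For \<open>T = t = n\<close> this is
  \<open>F n\<close>, which makes the missing part an admissible stake at time
  \<open>n\<close>.\<close>

lemma step_integral_measurable:
  fixes ps :: "(real \<times> real \<times> ('a \<Rightarrow> 'e::{real_normed_vector, second_countable_topology})) list"
  assumes "adapted_step F T ps" "0 \<le> t"
  shows "step_integral W ps t \<in> borel_measurable (F (max T t))"
  using assms(1)
proof (induction ps)
  case Nil
  show ?case by (simp add: step_integral_def)
next
  case (Cons p ps)
  obtain c d \<eta> where p: "p = (c, d, \<eta>)" by (cases p)
  have cd: "0 \<le> c" "c < d" "d \<le> T" "\<eta> \<in> borel_measurable (F c)"
    using Cons.prems by (auto simp: p strongly_measurable_iff_borel)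
  have [measurable]: "W (min d t) \<in> borel_measurable (F (max T t))" "W (min c t) \<in> borel_measurable (F (max T t))"
    "\<eta> \<in> borel_measurable (F (max T t))" "step_integral W ps t \<in> borel_measurable (F (max T t))"
    using cd assms(2) Cons
    by (auto simp: p intro!: measurable_F_mono[OF W_measurable_F] measurable_F_mono[OF cd(4)])
  show ?case unfolding p step_integral_Cons[abs_def] by measurable
qed

text \<open>A step with \<open>c < t\<close> has \<open>\<eta>\<close> measurable for
  \<open>F t\<close>; for \<open>t \<le> c\<close> its indicator vanishes.\<close>

lemma step_process_measurable_F:
  fixes ps :: "(real \<times> real \<times> ('a \<Rightarrow> 'e::{real_normed_vector, second_countable_topology})) list"
  assumes "adapted_step F T ps" "0 \<le> t"
  shows "step_process ps t \<in> borel_measurable (F t)"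
  using assms(1)
proof (induction ps)
  case Nil
  show ?case by (simp add: step_process_def)
next
  case (Cons p ps)
  obtain c d \<eta> where p: "p = (c, d, \<eta>)" by (cases p)
  have cd: "0 \<le> c" "\<eta> \<in> borel_measurable (F c)" and [measurable]: "step_process ps t \<in> borel_measurable (F t)"
    using Cons by (auto simp: p strongly_measurable_iff_borel)
  have [measurable]: "(\<lambda>\<omega>. indicator {c<..d} t *\<^sub>R \<eta> \<omega>) \<in> borel_measurable (F t)"
  proof (cases "c < t")
    case True
    hence [measurable]: "\<eta> \<in> borel_measurable (F t)" using measurable_F_mono[OF cd(2,1)] by simp
    show ?thesis by measurable
  qed simp
  show ?case unfolding p step_process_Cons[abs_def] by measurable
qed

lemma step_process_measurable_pair:
  fixes ps :: "(real \<times> real \<times> ('a \<Rightarrow> 'e::{real_normed_vector, second_countable_topology})) list"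
  assumes "adapted_step F T ps"
  shows "(\<lambda>(t, \<omega>). step_process ps t \<omega>) \<in> borel_measurable (restrict_space borel S \<Otimes>\<^sub>M M)"
  using assms
proof (induction ps)
  case (Cons p ps)
  obtain c d \<eta> where p: "p = (c, d, \<eta>)" by (cases p)
  have [measurable]: "\<eta> \<in> borel_measurable M" "(\<lambda>(t, \<omega>). step_process ps t \<omega>) \<in> borel_measurable (restrict_space borel S \<Otimes>\<^sub>M M)"
    using Cons measurable_F_M by (auto simp: p strongly_measurable_iff_borel)
  have [measurable]: "(indicator {c<..d} :: real \<Rightarrow> real) \<in> borel_measurable (restrict_space borel S)"
    by (intro measurable_restrict_space1) measurable
  show ?case unfolding p step_process_Cons split_beta' by measurable
qed (simp add: split_beta')

lemma space_predictable_sigma: "space (predictable_sigma M F) = {0..} \<times> space M"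
  and sets_predictable_sigma: "sets (predictable_sigma M F) = sigma_sets ({0..} \<times> space M)
    ({{s<..t} \<times> A | s t A. 0 \<le> s \<and> s < t \<and> A \<in> sets (F s)} \<union> {{0} \<times> A | A. A \<in> sets (F 0)})"
proof -
  have "A \<subseteq> space M" if "0 \<le> s" "A \<in> sets (F s)" for A s
    using sets.sets_into_space[OF that(2)] that by simp
  hence "{{s<..t} \<times> A | s t A. 0 \<le> s \<and> s < t \<and> A \<in> sets (F s)} \<union> {{0} \<times> A | A. A \<in> sets (F 0)}
    \<subseteq> Pow ({0..} \<times> space M)" by fastforce
  thus "space (predictable_sigma M F) = {0..} \<times> space M"
    "sets (predictable_sigma M F) = sigma_sets ({0..} \<times> space M)
    ({{s<..t} \<times> A | s t A. 0 \<le> s \<and> s < t \<and> A \<in> sets (F s)} \<union> {{0} \<times> A | A. A \<in> sets (F 0)})"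
    by (simp_all add: predictable_sigma_def)
qed

lemma step_process_predictable:
  fixes ps :: "(real \<times> real \<times> ('a \<Rightarrow> 'e::{real_normed_vector, second_countable_topology})) list"
  assumes "adapted_step F T ps"
  shows "(\<lambda>(t, \<omega>). step_process ps t \<omega>) \<in> borel_measurable (predictable_sigma M F)"
  using assms
proof (induction ps)
  case (Cons p ps)
  let ?P = "predictable_sigma M F"
  obtain c d \<eta> where p: "p = (c, d, \<eta>)" by (cases p)
  have cd: "0 \<le> c" "c < d" "\<eta> \<in> borel_measurable (F c)"
    and [measurable]: "(\<lambda>(t, \<omega>). step_process ps t \<omega>) \<in> borel_measurable ?P"
    using Cons by (auto simp: p strongly_measurable_iff_borel)
  have rect: "{c<..d} \<times> A \<in> sets ?P" if "A \<in> sets (F c)" for A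
    unfolding sets_predictable_sigma using that cd by (intro sigma_sets.Basic UnI1) blast
  have [measurable]: "(\<lambda>(t, \<omega>). indicator {c<..d} t *\<^sub>R \<eta> \<omega>) \<in> borel_measurable ?P"
  proof (rule measurableI)
    fix B :: "'e set" assume B: "B \<in> sets borel"
    have A: "\<eta> -` B \<inter> space M \<in> sets (F c)" using measurable_sets[OF cd(3) B] cd by simp
    have \<Omega>: "space M \<in> sets (F c)" using sets.top[of "F c"] cd by simp
    \<comment> \<open>Over the strip the preimage is a predictable rectangle; outside it the process
      is 0, so the complement is added exactly when \<open>0 \<in> B\<close>.\<close>
    have "(\<lambda>(t, \<omega>). indicator {c<..d} t *\<^sub>R \<eta> \<omega>) -` B \<inter> space ?P =
      {c<..d} \<times> (\<eta> -` B \<inter> space M) \<union> (if 0 \<in> B then space ?P - {c<..d} \<times> space M else {})"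
      using cd(1) by (auto simp: space_predictable_sigma indicator_def of_bool_def split: if_splits)
    also have "\<dots> \<in> sets ?P" using rect[OF A] rect[OF \<Omega>] by auto
    finally show "(\<lambda>(t, \<omega>). indicator {c<..d} t *\<^sub>R \<eta> \<omega>) -` B \<inter> space ?P \<in> sets ?P" .
  qed simp
  have "(\<lambda>x. (case x of (t, \<omega>) \<Rightarrow> indicator {c<..d} t *\<^sub>R \<eta> \<omega>) + (case x of (t, \<omega>) \<Rightarrow> step_process ps t \<omega>))
     \<in> borel_measurable ?P" by measurable
  thus ?case by (simp add: p split_beta')
qed (simp add: split_beta')

lemma step_integral_continuous:
  assumes "adapted_step F T ps" "continuous_on {0..} (\<lambda>t. W t \<omega>)"
  shows "continuous_on {0..} (\<lambda>t. step_integral W ps t \<omega>)"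
  using assms(1)
proof (induction ps)
  case (Cons p ps)
  obtain c d \<eta> where p: "p = (c, d, \<eta>)" by (cases p)
  have "continuous_on {0..} (\<lambda>t. W (min e t) \<omega>)" if "0 \<le> e" for e
    by (rule continuous_on_compose2[OF assms(2)]) (use that in \<open>auto intro!: continuous_intros\<close>)
  thus ?case using Cons by (auto simp: p intro!: continuous_intros)
qed simp

text \<open>Later lists only add steps that start later, so the value at \<open>t\<close> can be
  read off from any \<open>L m\<close> with \<open>t \<le> m\<close>. On \<open>[0,T]\<close> a
  single truncated list therefore represents the integrand.\<close>

lemma exists_integral_process:
  fixes L :: "nat \<Rightarrow> (real \<times> real \<times> ('a \<Rightarrow> 'e::{real_normed_vector, second_countable_topology})) list"
  assumes L: "\<And>n. adapted_step F (real n) (L n)"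
    and extends: "\<And>n. \<exists>ps. L (Suc n) = L n @ ps \<and> starts_after (real n) ps"
  obtains \<phi> \<zeta> where "strongly_predictable M F \<phi>" "integral_process M F W \<phi> \<zeta>"
    "\<And>n. AE \<omega> in M. \<zeta> (real n) \<omega> = step_integral W (L n) (real n) \<omega>"
proof -
  have extends': "\<exists>ps. L n = L m @ ps \<and> starts_after (real m) ps" if "m \<le> n" for m n
    using that
  proof (induction n rule: dec_induct)
    case base
    show ?case by (simp add: starts_after_def)
  next
    case (step n)
    then obtain ps where ps: "L n = L m @ ps" "starts_after (real m) ps" by blast
    obtain qs where qs: "L (Suc n) = L n @ qs" "starts_after (real n) qs" using extends by blast
    have "starts_after (real m) qs" using starts_after_mono[OF qs(2)] step by simp
    hence "starts_after (real m) (ps @ qs)" using ps by (auto simp: starts_after_def)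
    thus ?case using ps qs by auto
  qed
  have stable: "step_integral W (L n) t \<omega> = step_integral W (L m) t \<omega>"
    "step_process (L n) t \<omega> = step_process (L m) t \<omega>" if mn: "m \<le> n" "t \<le> real m" for m n t \<omega>
  proof -
    obtain ps where ps: "L n = L m @ ps" "starts_after (real m) ps" using extends'[OF mn(1)] by blast
    have "adapted_step F (real n) ps" using L[of n] by (simp add: ps adapted_step_append)
    note step_before_start[OF ps(2) this mn(2)]
    thus "step_integral W (L n) t \<omega> = step_integral W (L m) t \<omega>"
      "step_process (L n) t \<omega> = step_process (L m) t \<omega>"
      by (simp_all add: ps step_integral_append step_process_append)
  qed
  obtain N where N: "N \<in> null_sets M" "\<And>\<omega>. \<omega> \<in> space M - N \<Longrightarrow> continuous_on {0..} (\<lambda>t. W t \<omega>)"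
  proof -
    have "AE \<omega> in M. continuous_on {0..} (\<lambda>t. W t \<omega>)" using brownian by (simp add: brownian_motion_def)
    then obtain N where "{\<omega>\<in>space M. \<not> continuous_on {0..} (\<lambda>t. W t \<omega>)} \<subseteq> N" "emeasure M N = 0" "N \<in> sets M"
      by (rule AE_E)
    thus thesis by (intro that[of N] null_setsI) auto
  qed
  define \<phi> where "\<phi> t = step_process (L (nat \<lceil>t\<rceil>)) t" for t
  \<comment> \<open>The value 0 on \<open>N\<close> makes every path continuous, as the integral
    process must be; elsewhere it is the step integral.\<close>
  define \<zeta> where "\<zeta> t \<omega> = (if \<omega> \<in> N then 0 else step_integral W (L (nat \<lceil>t\<rceil>)) t \<omega>)" for t \<omega>
  have \<phi>: "\<phi> t \<omega> = step_process (L m) t \<omega>"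
    and \<zeta>: "\<zeta> t \<omega> = (if \<omega> \<in> N then 0 else step_integral W (L m) t \<omega>)" if "t \<le> real m" for t m \<omega>
  proof -
    have "nat \<lceil>t\<rceil> \<le> m" "t \<le> real (nat \<lceil>t\<rceil>)" using that real_nat_ceiling_ge[of t] by (auto simp: ceiling_le_iff nat_le_iff)
    thus "\<phi> t \<omega> = step_process (L m) t \<omega>" "\<zeta> t \<omega> = (if \<omega> \<in> N then 0 else step_integral W (L m) t \<omega>)"
      unfolding \<phi>_def \<zeta>_def using stable[of "nat \<lceil>t\<rceil>" m t \<omega>] by presburger+
  qed
  have pred: "strongly_predictable M F \<phi>"
    unfolding strongly_predictable_def strongly_measurable_iff_borel
  proof (rule borel_measurable_LIMSEQ_metric)
    show "(\<lambda>(t, \<omega>). step_process (L m) t \<omega>) \<in> borel_measurable (predictable_sigma M F)" for m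
      by (rule step_process_predictable[OF L])
    fix x :: "real \<times> 'a"
    obtain t \<omega> where x: "x = (t, \<omega>)" by (cases x)
    obtain m0 :: nat where "t \<le> real m0" using real_arch_simple by blast
    hence "\<forall>m\<ge>m0. step_process (L m) t \<omega> = \<phi> t \<omega>" using \<phi> order_trans of_nat_le_iff by metis
    hence "eventually (\<lambda>m. step_process (L m) t \<omega> = \<phi> t \<omega>) sequentially"
      unfolding eventually_sequentially by blast
    thus "(\<lambda>m. case x of (t, \<omega>) \<Rightarrow> step_process (L m) t \<omega>) \<longlonglongrightarrow> (case x of (t, \<omega>) \<Rightarrow> \<phi> t \<omega>)"
      unfolding x prod.case by (rule tendsto_eventually)
  qed
  have \<zeta>_meas: "\<zeta> t \<in> borel_measurable M" if t: "0 \<le> t" for t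
  proof -
    obtain m :: nat where m: "t \<le> real m" using real_arch_simple by blast
    have [measurable]: "N \<in> sets M" using N by auto
    have [measurable]: "step_integral W (L m) t \<in> borel_measurable M"
      using measurable_F_M[OF step_integral_measurable[OF L t]] t by simp
    show ?thesis unfolding \<zeta>[OF m, abs_def] by measurable
  qed
  have \<zeta>_cont: "continuous_on {0..} (\<lambda>t. \<zeta> t \<omega>)" if \<omega>: "\<omega> \<in> space M" for \<omega>
  proof (cases "\<omega> \<in> N")
    case True
    thus ?thesis by (simp add: \<zeta>_def)
  next
    case False
    hence W: "continuous_on {0..} (\<lambda>t. W t \<omega>)" using N \<omega> by blast
    show ?thesis unfolding continuous_on_eq_continuous_within
    proof
      fix t :: real assume t: "t \<in> {0..}"
      \<comment> \<open>Strict inequality gives a relative neighbourhood of \<open>t\<close> on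
        which \<open>\<zeta>\<close> is the step integral of the one list
        \<open>L m\<close>.\<close>
      obtain m :: nat where m: "t < real m" using reals_Archimedean2 by blast
      have "continuous_on ({0..} \<inter> {..<real m}) (\<lambda>t. \<zeta> t \<omega>)"
        using continuous_on_subset[OF step_integral_continuous[OF L[of m] W], of "{0..} \<inter> {..<real m}"] False
        by (subst continuous_on_cong[OF refl, of _ _ "\<lambda>t. step_integral W (L m) t \<omega>"])
          (auto simp: \<zeta>[of _ m])
      hence "continuous (at t within {0..} \<inter> {..<real m}) (\<lambda>t. \<zeta> t \<omega>)"
        unfolding continuous_on_eq_continuous_within by (rule bspec) (use t m in auto)
      moreover have "at t within {0..} \<inter> {..<real m} = at t within {0..}"
        using m by (intro at_within_nhd[of t "{..<real m}"]) auto
      ultimately show "continuous (at t within {0..}) (\<lambda>t. \<zeta> t \<omega>)" by simp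
    qed
  qed
  have int: "has_stoch_integral M F W T \<phi> \<zeta>" if T: "0 < T" for T
  proof -
    obtain m :: nat where m: "T \<le> real m" using real_arch_simple by blast
    \<comment> \<open>The steps of \<open>L m\<close> may end after \<open>T\<close>, whereas
      adapted steps on \<open>[0,T]\<close> may not.\<close>
    define ps where "ps = truncate_steps T (L m)"
    have ps: "adapted_step F T ps" unfolding ps_def by (rule adapted_truncate_steps[OF L])
    have ps_eq: "step_integral W ps t \<omega> = step_integral W (L m) t \<omega>" "step_process ps t \<omega> = \<phi> t \<omega>"
      if "t \<le> T" for t \<omega>
      using truncate_steps[OF L that] that m \<phi>[of t m] by (auto simp: ps_def)
    have "admissible_integrand M F T \<phi>"
      unfolding admissible_integrand_def strongly_measurable_iff_borel
    proof (intro conjI ballI allI AE_I2)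
      have "(\<lambda>(t, \<omega>). step_process ps t \<omega>) \<in> borel_measurable (restrict_space borel {0..T} \<Otimes>\<^sub>M M)"
        by (rule step_process_measurable_pair[OF ps])
      thus "(\<lambda>(t, \<omega>). \<phi> t \<omega>) \<in> borel_measurable (restrict_space borel {0..T} \<Otimes>\<^sub>M M)"
        by (rule measurable_cong[THEN iffD1, rotated]) (auto simp: space_pair_measure space_restrict_space ps_eq)
      show "\<phi> t \<in> borel_measurable (F t)" if "t \<in> {0..T}" for t
      proof -
        have "step_process ps t = \<phi> t" by (rule ext) (use ps_eq(2) that in simp)
        thus ?thesis using step_process_measurable_F[OF ps, of t] that by simp
      qed
      fix x :: "'e \<Rightarrow>\<^sub>L real" and \<omega>
      have "sqnorm_L2 T (\<lambda>t. blinfun_apply x (\<phi> t \<omega>)) = sqnorm_L2 T (\<lambda>t. blinfun_apply x (step_process ps t \<omega>))"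
        unfolding sqnorm_L2_def by (intro nn_integral_cong) (simp add: ps_eq(2) indicator_def)
      thus "sqnorm_L2 T (\<lambda>t. blinfun_apply x (\<phi> t \<omega>)) < \<infinity>"
        using sqnorm_L2_step_process_finite[of T x ps \<omega>] T by simp
    qed
    moreover have "\<forall>t\<in>{0..T}. strongly_measurable M (\<zeta> t)"
      using \<zeta>_meas by (auto simp: strongly_measurable_iff_borel)
    moreover have "\<forall>\<omega>\<in>space M. continuous_on {0..T} (\<lambda>t. \<zeta> t \<omega>)"
      by (intro ballI continuous_on_subset[OF \<zeta>_cont]) auto
    moreover have "tendsto_L0 M (dist_L2 T) (\<lambda>_ \<omega> t. blinfun_apply x (step_process ps t \<omega>)) (\<lambda>\<omega> t. blinfun_apply x (\<phi> t \<omega>))"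
      for x :: "'e \<Rightarrow>\<^sub>L real"
      by (rule tendsto_L0_const_null[of "{}"]) (simp, rule dist_L2_eq_0, simp add: ps_eq(2))
    moreover have "tendsto_L0 M (dist_C T) (\<lambda>_ \<omega> t. step_integral W ps t \<omega>) (\<lambda>\<omega> t. \<zeta> t \<omega>)"
    proof (rule tendsto_L0_const_null[OF N(1)])
      fix \<omega> assume \<omega>: "\<omega> \<in> space M - N"
      have "step_integral W ps t \<omega> = \<zeta> t \<omega>" if "t \<in> {0..T}" for t
      proof -
        have "t \<le> T" "t \<le> real m" using that m by auto
        thus ?thesis using ps_eq(1)[of t \<omega>] \<zeta>[of t m \<omega>] \<omega> by (metis DiffD2)
      qed
      hence "ennreal (dist (step_integral W ps t \<omega>) (\<zeta> t \<omega>)) = 0" if "t \<in> {0..T}" for t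
        using that by simp
      thus "dist_C T (\<lambda>t. step_integral W ps t \<omega>) (\<lambda>t. \<zeta> t \<omega>) = 0"
        unfolding dist_C_def using T by simp
    qed
    ultimately show ?thesis unfolding has_stoch_integral_def using ps
      by (intro conjI exI[of _ "\<lambda>_. ps"] allI)
  qed
  have "integral_process M F W \<phi> \<zeta>"
    unfolding integral_process_def using \<zeta>_cont int by blast
  moreover have "AE \<omega> in M. \<zeta> (real n) \<omega> = step_integral W (L n) (real n) \<omega>" for n
    using AE_not_in[OF N(1)] by eventually_elim (simp add: \<zeta>_def)
  ultimately show thesis using that pred by blast
qed

section \<open>Successive choice of the steps and convergence along integer times\<close>

lemma exists_steps_near_targets:
  fixes \<tau> :: "nat \<Rightarrow> 'a \<Rightarrow> 'e::{real_normed_vector, second_countable_topology}"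
  assumes \<tau>: "\<And>n. \<tau> n \<in> borel_measurable (F (real n))"
  obtains L where "\<And>n. adapted_step F (real n) (L n)"
    "\<And>n. \<exists>ps. L (Suc n) = L n @ ps \<and> starts_after (real n) ps"
    "\<And>n. prob {\<omega>\<in>space M. 1 / real (Suc n) < dist (step_integral W (L (Suc n)) (real (Suc n)) \<omega>) (\<tau> n \<omega>)}
      < 1 / real (Suc n)"
proof -
  define Q where "Q n l l' \<longleftrightarrow> (\<exists>ps. l' = l @ ps \<and> starts_after (real n) ps) \<and>
    prob {\<omega>\<in>space M. 1 / real (Suc n) < dist (step_integral W l' (real (Suc n)) \<omega>) (\<tau> n \<omega>)} < 1 / real (Suc n)"
    for n and l l' :: "(real \<times> real \<times> ('a \<Rightarrow> 'e)) list"
  have "\<exists>L. \<forall>n. adapted_step F (real n) (L n) \<and> Q n (L n) (L (Suc n))"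
  proof (rule dependent_nat_choice)
    show "\<exists>l. adapted_step F (real 0) l" using adapted_step_Nil by blast
    fix l :: "(real \<times> real \<times> ('a \<Rightarrow> 'e)) list" and n assume l: "adapted_step F (real n) l"
    \<comment> \<open>What is missing at time \<open>n\<close> from the target. The integral of
      \<open>l\<close> no longer changes after \<open>n\<close>, so the new steps only have to
      produce \<open>\<eta>\<close> on the next unit interval.\<close>
    define \<eta> where "\<eta> \<omega> = \<tau> n \<omega> - step_integral W l (real n) \<omega>" for \<omega>
    have [measurable]: "step_integral W l (real n) \<in> borel_measurable (F (real n))"
      using step_integral_measurable[OF l, of "real n"] by simp
    note [measurable] = \<tau>
    have "\<eta> \<in> borel_measurable (F (real n))" unfolding \<eta>_def by measurable
    then obtain ps where ps: "adapted_step F (real (Suc n)) ps" "\<forall>(c, d, \<xi>)\<in>set ps. real n \<le> c"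
      "prob {\<omega>\<in>space M. 1 / real (Suc n) < dist (step_integral W ps (real (Suc n)) \<omega>) (\<eta> \<omega>)} < 1 / real (Suc n)"
      using step_integral_approximates[of "real n" "real (Suc n)" \<eta> "1 / real (Suc n)"] by auto
    have "dist (step_integral W (l @ ps) (real (Suc n)) \<omega>) (\<tau> n \<omega>)
        = dist (step_integral W ps (real (Suc n)) \<omega>) (\<eta> \<omega>)" for \<omega>
      using step_integral_eq_at_end[OF l, of "real (Suc n)" W \<omega>]
      by (simp add: step_integral_append \<eta>_def dist_norm algebra_simps)
    hence "Q n l (l @ ps)" using ps by (auto simp: Q_def starts_after_def)
    moreover have "adapted_step F (real (Suc n)) (l @ ps)"
      using adapted_step_mono[OF l, of "real (Suc n)"] ps by (simp add: adapted_step_append)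
    ultimately show "\<exists>l'. adapted_step F (real (Suc n)) l' \<and> Q n l l'" by blast
  qed
  thus thesis using that unfolding Q_def by blast
qed

end

theorem theorem3p4:
  fixes M :: "'a measure"
    and F :: "real \<Rightarrow> 'a measure"
    and W :: "real \<Rightarrow> 'a \<Rightarrow> real"
  assumes "prob_space M"
    and "complete_filtration M F"
    and "brownian_motion M F W"
    and "countably_generated_mod_null M (F_infinity M F)"
  shows "\<exists>(\<phi> :: real \<Rightarrow> 'a \<Rightarrow> 'e::{banach, second_countable_topology}) \<zeta>.
           strongly_predictable M F \<phi> \<and>
           locally_stoch_integrable M F W \<phi> \<and>
           integral_process M F W \<phi> \<zeta> \<and>
           (\<forall>\<xi> :: 'a \<Rightarrow> 'e. strongly_measurable (F_infinity M F) \<xi> \<longrightarrow>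
              (\<exists>n :: nat \<Rightarrow> nat. strict_mono n \<and>
                 tendsto_L0 M edist (\<lambda>k. \<zeta> (real (n k))) \<xi>))"
proof -
  interpret filtered_brownian_motion M F W
    using assms by (simp add: filtered_brownian_motion_def filtered_brownian_motion_axioms_def)
  obtain \<tau> :: "nat \<Rightarrow> 'a \<Rightarrow> 'e" where \<tau>: "\<And>n. \<tau> n \<in> borel_measurable (F (real n))"
    "\<And>\<xi> m. \<xi> \<in> borel_measurable (F_infinity M F) \<Longrightarrow> prob_approximable (\<tau> ` {m..}) \<xi>"
    using exists_target_sequence[OF assms(4)] by blast
  obtain L where L: "\<And>n. adapted_step F (real n) (L n)"
      "\<And>n. \<exists>ps. L (Suc n) = L n @ ps \<and> starts_after (real n) ps"
    and near: "\<And>n. prob {\<omega>\<in>space M. 1 / real (Suc n) < dist (step_integral W (L (Suc n)) (real (Suc n)) \<omega>) (\<tau> n \<omega>)}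
      < 1 / real (Suc n)"
    using exists_steps_near_targets[OF \<tau>(1)] by blast
  obtain \<phi> \<zeta> where \<phi>: "strongly_predictable M F \<phi>" "integral_process M F W \<phi> \<zeta>"
    and AE_\<zeta>: "\<And>n. AE \<omega> in M. \<zeta> (real n) \<omega> = step_integral W (L n) (real n) \<omega>"
    using exists_integral_process[OF L] by blast
  have [measurable]: "step_integral W (L n) (real n) \<in> borel_measurable M" for n
    using measurable_F_M[OF step_integral_measurable[OF L(1), of "real n" n]] by simp
  have \<zeta>_meas [measurable]: "\<zeta> (real n) \<in> borel_measurable M" for n
  proof -
    have "has_stoch_integral M F W (real (Suc n)) \<phi> \<zeta>"
      using \<phi>(2) unfolding integral_process_def by simp
    thus ?thesis unfolding has_stoch_integral_def strongly_measurable_iff_borel by simp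
  qed
  have [measurable]: "\<tau> n \<in> borel_measurable M" for n using measurable_F_M[OF \<tau>(1)] by simp
  have "\<exists>n. strict_mono n \<and> tendsto_L0 M edist (\<lambda>k. \<zeta> (real (n k))) \<xi>"
    if "strongly_measurable (F_infinity M F) \<xi>" for \<xi> :: "'a \<Rightarrow> 'e"
  proof (rule exists_strict_mono_tendsto_L0[OF \<zeta>_meas])
    have \<xi>: "\<xi> \<in> borel_measurable (F_infinity M F)" using that by (simp add: strongly_measurable_iff_borel)
    show \<xi>M [measurable]: "\<xi> \<in> borel_measurable M"
      by (rule measurable_from_subalg[OF subalgebra_F_infinity \<xi>])
    fix \<epsilon> :: real and m :: nat assume \<epsilon>: "0 < \<epsilon>"
    \<comment> \<open>Half of \<open>\<epsilon>\<close> is for the steering error at the target,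
      half for the distance of the target from \<open>\<xi>\<close>; taking \<open>n \<ge> i\<close>
      keeps the former tolerance below \<open>\<epsilon> / 2\<close>.\<close>
    obtain i where i: "1 / real (Suc i) < \<epsilon> / 2" using nat_approx_posE[of "\<epsilon> / 2"] \<epsilon> by auto
    have "\<exists>g\<in>\<tau> ` {max i m..}. prob {\<omega>\<in>space M. \<epsilon> / 2 < dist (g \<omega>) (\<xi> \<omega>)} < \<epsilon> / 2"
      using \<tau>(2)[OF \<xi>, of "max i m"] half_gt_zero[OF \<epsilon>] unfolding prob_approximable_def by blast
    then obtain n where n: "max i m \<le> n" "prob {\<omega>\<in>space M. \<epsilon> / 2 < dist (\<tau> n \<omega>) (\<xi> \<omega>)} < \<epsilon> / 2"
      by auto
    let ?I = "step_integral W (L (Suc n)) (real (Suc n))" and ?\<delta> = "1 / real (Suc n)"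
    have \<delta>: "?\<delta> < \<epsilon> / 2"
      using i n by (intro le_less_trans[OF _ i] divide_left_mono) auto
    have "prob {\<omega>\<in>space M. \<epsilon> < dist (\<zeta> (real (Suc n)) \<omega>) (\<xi> \<omega>)} \<le>
      prob ({\<omega>\<in>space M. ?\<delta> < dist (?I \<omega>) (\<tau> n \<omega>)} \<union> {\<omega>\<in>space M. \<epsilon> / 2 < dist (\<tau> n \<omega>) (\<xi> \<omega>)})"
    \<comment> \<open>The inclusion of events holds only almost everywhere, since
      \<open>\<zeta>\<close> was altered on a null set.\<close>
    proof (rule finite_measure_mono_AE)
      show "AE \<omega> in M. \<omega> \<in> {\<omega>\<in>space M. \<epsilon> < dist (\<zeta> (real (Suc n)) \<omega>) (\<xi> \<omega>)} \<longrightarrow>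
        \<omega> \<in> {\<omega>\<in>space M. ?\<delta> < dist (?I \<omega>) (\<tau> n \<omega>)} \<union> {\<omega>\<in>space M. \<epsilon> / 2 < dist (\<tau> n \<omega>) (\<xi> \<omega>)}"
        using AE_\<zeta>[of "Suc n"]
      proof eventually_elim
        case (elim \<omega>)
        show ?case using elim dist_triangle[of "?I \<omega>" "\<xi> \<omega>" "\<tau> n \<omega>"] \<delta>
          by (auto simp del: of_nat_Suc)
      qed
    qed measurable
    also have "\<dots> \<le> prob {\<omega>\<in>space M. ?\<delta> < dist (?I \<omega>) (\<tau> n \<omega>)} + prob {\<omega>\<in>space M. \<epsilon> / 2 < dist (\<tau> n \<omega>) (\<xi> \<omega>)}"
      by (intro measure_Un_le) measurable
    also have "\<dots> < \<epsilon>" using near[of n] n \<delta> by linarith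
    \<comment> \<open>The target \<open>\<tau> n\<close> is reached at time \<open>n + 1\<close>,
      hence the index \<open>Suc n\<close>.\<close>
    finally show "\<exists>n>m. prob {\<omega>\<in>space M. \<epsilon> < dist (\<zeta> (real n) \<omega>) (\<xi> \<omega>)} < \<epsilon>"
      using n by (intro exI[of _ "Suc n"]) auto
  qed
  moreover have "locally_stoch_integrable M F W \<phi>"
    using \<phi>(2) unfolding integral_process_def locally_stoch_integrable_def stoch_integrable_def by blast
  ultimately show ?thesis using \<phi> by blast
qed

end
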